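(* There exist C*-transitive operators on $\tilde\ell_2(B_0(H))$ and topologically numerically transitive operators on $\ell^2(\mathbb N)$ which are neither weakly $n$-supercyclic nor $N$-weakly supercyclic, for any $n,N\in\mathbb N$.
   Context: $H$ is a complex separable Hilbert space with an orthonormal basis $\{e_j\}_{j\in\mathbb Z}$, $B_0(H)$ is the C*-algebra of compact operators on $H$. $\tilde\ell_2(B_0(H))$ is the standard Hilbert module over $B_0(H)$: sequences $x=(x_j)_{j\in\mathbb N}$ in $B_0(H)$ with $\sum_j x_j^*x_j$ norm convergent, with $\varphi(x,y)=\sum_{j}y_j^*x_j$ and norm $\|x\|=\|\varphi(x,x)\|^{1/2}$. With $X=\tilde\ell_2(B_0(H))$ and unit sphere $S(X)$, $T\in\mathcal B(X)$ is C*-transitive if for every nonempty open $W\subseteq S(X)\times S(X)$ and nonempty open $O\subseteq B_0(H)$ there exist $n\in\mathbb N$ and $(x,y)\in W$ with $\varphi(T^nx,y)\in O$. For a complex Banach space $X$, $\Pi(X):=\{(x,x^* )\in S_X\times S_{X^*}:x^*(x)=1\}$ ($S_X,S_{X^*}$ unit spheres) with the topology induced by the norm $\max\{\|x\|,\|x^*\|\}$; $T\in\mathcal B(X)$ is topologically numerically transitive if for every nonempty open $U\subset\Pi(X)$ and nonempty open $V\subset\mathbb C$ there exist $n\ge0$ and $(x,x^* )\in U$ with $x^*(T^nx)\in V$. $T\in\mathcal B(X)$ is weakly $n$-supercyclic if there is an $n$-dimensional subspace $M$ of $X$ such that $\bigcup_{k=1}^\infty T^k(M)$ is weakly dense in $X$.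 $T$ is $N$-weakly supercyclic if there is $x\in X$ such that for every continuous surjective linear map $\gamma:X\to\mathbb C^N$ the set $\gamma(\{\lambda T^nx:n\ge0,\lambda\in\mathbb C\})$ is dense in $\mathbb C^N$. *)

theory Defs
  imports "HOL-Analysis.Analysis"
begin

section \<open>Complex normed spaces\<close>

class scaleC =
  fixes scaleC :: "complex \<Rightarrow> 'a \<Rightarrow> 'a" (infixr "*\<^sub>C" 75)

class complex_vector = real_vector + scaleC +
  assumes scaleC_add_right: "a *\<^sub>C (x + y) = a *\<^sub>C x + a *\<^sub>C y"
    and scaleC_add_left: "(a + b) *\<^sub>C x = a *\<^sub>C x + b *\<^sub>C x"
    and scaleC_scaleC: "a *\<^sub>C (b *\<^sub>C x) = (a * b) *\<^sub>C x"
    and scaleC_one: "1 *\<^sub>C x = x"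
    and scaleR_scaleC: "r *\<^sub>R x = complex_of_real r *\<^sub>C x"

class complex_normed_vector = real_normed_vector + complex_vector +
  assumes norm_scaleC: "norm (a *\<^sub>C x) = cmod a * norm x"

global_interpretation complex_vector:
  vector_space "scaleC :: complex \<Rightarrow> 'a \<Rightarrow> 'a :: complex_vector"
  defines cdependent = complex_vector.dependent
    and cspan = complex_vector.span
  by unfold_locales
    (simp_all add: scaleC_add_right scaleC_add_left scaleC_scaleC scaleC_one)

definition clinear :: "('a::complex_vector \<Rightarrow> 'b::complex_vector) \<Rightarrow> bool" where
  "clinear f \<longleftrightarrow> Vector_Spaces.linear scaleC scaleC f"

definition bounded_clinear ::
  "('a::complex_normed_vector \<Rightarrow> 'b::complex_normed_vector) \<Rightarrow> bool" where
  "bounded_clinear f \<longleftrightarrow> clinear f \<and> (\<exists>K. \<forall>x. norm (f x) \<le> K * norm x)"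

lemma clinearI:
  assumes "\<And>x y. f (x + y) = f x + f y" "\<And>c x. f (c *\<^sub>C x) = c *\<^sub>C f x"
  shows "clinear f"
  unfolding clinear_def by unfold_locales (use assms in auto)

lemma clinear_add: "clinear f \<Longrightarrow> f (x + y) = f x + f y"
  unfolding clinear_def by (simp add: Vector_Spaces.linear_iff)

lemma clinear_scaleC: "clinear f \<Longrightarrow> f (c *\<^sub>C x) = c *\<^sub>C f x"
  unfolding clinear_def by (simp add: Vector_Spaces.linear_iff)

instantiation complex :: complex_normed_vector
begin

definition scaleC_complex :: "complex \<Rightarrow> complex \<Rightarrow> complex" where
  "scaleC_complex = (*)"

instance
  by standard (simp_all add: scaleC_complex_def algebra_simps scaleR_conv_of_real norm_mult)

end

lemma bounded_linear_scaleC: "bounded_linear (\<lambda>x::'a::complex_normed_vector. c *\<^sub>C x)"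
proof (rule bounded_linear_intro[where K="cmod c"])
  show "c *\<^sub>C (x + y) = c *\<^sub>C x + c *\<^sub>C y" for x y :: 'a by (rule scaleC_add_right)
  show "c *\<^sub>C (r *\<^sub>R x) = r *\<^sub>R (c *\<^sub>C x)" for r and x :: 'a
    by (simp add: scaleR_scaleC scaleC_scaleC mult.commute)
  show "norm (c *\<^sub>C x) \<le> norm x * cmod c" for x :: 'a
    by (simp add: norm_scaleC)
qed

instantiation blinfun :: (real_normed_vector, complex_normed_vector) complex_normed_vector
begin

lift_definition scaleC_blinfun :: "complex \<Rightarrow> 'a \<Rightarrow>\<^sub>L 'b \<Rightarrow> 'a \<Rightarrow>\<^sub>L 'b"
  is "\<lambda>c f x. c *\<^sub>C f x"
  by (rule bounded_linear_compose[OF bounded_linear_scaleC])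

lemma norm_scaleC_blinfun_le: "norm (c *\<^sub>C f) \<le> cmod c * norm (f :: 'a \<Rightarrow>\<^sub>L 'b)"
proof (rule norm_blinfun_bound)
  fix x
  have "norm (f x) \<le> norm f * norm x" by (rule norm_blinfun)
  then show "norm ((c *\<^sub>C f) x) \<le> cmod c * norm f * norm x"
    by (simp add: scaleC_blinfun.rep_eq norm_scaleC mult.assoc mult_left_mono)
qed simp

instance
proof
  fix a b :: complex and x y :: "'a \<Rightarrow>\<^sub>L 'b" and r :: real
  show "a *\<^sub>C (x + y) = a *\<^sub>C x + a *\<^sub>C y"
    by (rule blinfun_eqI) (simp add: scaleC_blinfun.rep_eq plus_blinfun.rep_eq scaleC_add_right)
  show "(a + b) *\<^sub>C x = a *\<^sub>C x + b *\<^sub>C x"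
    by (rule blinfun_eqI) (simp add: scaleC_blinfun.rep_eq plus_blinfun.rep_eq scaleC_add_left)
  show *: "a *\<^sub>C (b *\<^sub>C x) = (a * b) *\<^sub>C x" for a b and x :: "'a \<Rightarrow>\<^sub>L 'b"
    by (rule blinfun_eqI) (simp add: scaleC_blinfun.rep_eq scaleC_scaleC)
  show one: "1 *\<^sub>C x = x" for x :: "'a \<Rightarrow>\<^sub>L 'b"
    by (rule blinfun_eqI) (simp add: scaleC_blinfun.rep_eq scaleC_one)
  show "r *\<^sub>R x = complex_of_real r *\<^sub>C x"
    by (rule blinfun_eqI) (simp add: scaleC_blinfun.rep_eq scaleR_blinfun.rep_eq scaleR_scaleC)
  show "norm (a *\<^sub>C x) = cmod a * norm x"
  proof (cases "a = 0")
    case True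
    then show ?thesis using norm_scaleC_blinfun_le[of a x] by simp
  next
    case False
    have "norm x = norm (inverse a *\<^sub>C (a *\<^sub>C x))"
      using False by (simp add: * one)
    also have "\<dots> \<le> cmod (inverse a) * norm (a *\<^sub>C x)" by (rule norm_scaleC_blinfun_le)
    finally have "cmod a * norm x \<le> norm (a *\<^sub>C x)"
      using False by (simp add: norm_inverse inverse_eq_divide norm_divide pos_le_divide_eq mult.commute)
    with norm_scaleC_blinfun_le[of a x] show ?thesis by simp
  qed
qed

end

section \<open>Complex Hilbert spaces and compact operators\<close>

text \<open>The inner product is linear in its first argument.\<close>

class chilbert_space = complex_normed_vector + banach +
  fixes cinner :: "'a \<Rightarrow> 'a \<Rightarrow> complex"
  assumes cinner_commute: "cinner x y = cnj (cinner y x)"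
    and cinner_add_left: "cinner (x + y) z = cinner x z + cinner y z"
    and cinner_scaleC_left: "cinner (c *\<^sub>C x) y = c * cinner x y"
    and cinner_self: "cinner x x = complex_of_real ((norm x)\<^sup>2)"

definition orthonormal_basis :: "('i \<Rightarrow> 'h::chilbert_space) \<Rightarrow> bool" where
  "orthonormal_basis e \<longleftrightarrow>
     (\<forall>i j. cinner (e i) (e j) = (if i = j then 1 else 0)) \<and> closure (cspan (range e)) = UNIV"

text \<open>The type \<^typ>\<open>'h \<Rightarrow>\<^sub>L 'h\<close> consists of real-linear operators, so complex linearity is required
  separately; the norm of \<^typ>\<open>'h \<Rightarrow>\<^sub>L 'h\<close> is the operator norm.\<close>

definition compact_operators :: "('h::chilbert_space \<Rightarrow>\<^sub>L 'h) set" where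
  "compact_operators = {A. clinear (blinfun_apply A) \<and> compact (closure (blinfun_apply A ` cball 0 1))}"

definition adjoint_op :: "('h::chilbert_space \<Rightarrow>\<^sub>L 'h) \<Rightarrow> 'h \<Rightarrow>\<^sub>L 'h" where
  "adjoint_op A = (THE B :: 'h \<Rightarrow>\<^sub>L 'h. \<forall>x y. cinner (A x) y = cinner x (B y))"

lemma cinner_add_right: "cinner x (y + z) = cinner x y + cinner x (z::'a::chilbert_space)"
  by (metis cinner_add_left cinner_commute complex_cnj_add)

lemma cinner_scaleC_right: "cinner x (c *\<^sub>C y) = cnj c * cinner x (y::'a::chilbert_space)"
  by (metis cinner_commute cinner_scaleC_left complex_cnj_mult)

lemma scaleC_minus1: "(-1) *\<^sub>C x = - (x::'a::complex_vector)"
  using scaleR_scaleC[of "-1" x] by simp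

lemma scaleC_zero_left [simp]: "0 *\<^sub>C x = (0::'a::complex_vector)"
  using scaleR_scaleC[of 0 x] by simp

lemma cinner_minus_left: "cinner (- x) y = - cinner x (y::'a::chilbert_space)"
  using cinner_scaleC_left[of "-1" x y] by (simp add: scaleC_minus1)

lemma cinner_minus_right: "cinner x (- y) = - cinner x (y::'a::chilbert_space)"
  using cinner_scaleC_right[of x "-1" y] by (simp add: scaleC_minus1)

lemma cinner_diff_left: "cinner (x - y) z = cinner x z - cinner y (z::'a::chilbert_space)"
  using cinner_add_left[of x "-y" z] by (simp add: cinner_minus_left)

lemma cinner_diff_right: "cinner x (y - z) = cinner x y - cinner x (z::'a::chilbert_space)"
  using cinner_add_right[of x y "-z"] by (simp add: cinner_minus_right)

lemma cinner_zero_left [simp]: "cinner 0 (y::'a::chilbert_space) = 0"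
  using cinner_scaleC_left[of 0 0 y] by simp

lemma cinner_zero_right [simp]: "cinner (y::'a::chilbert_space) 0 = 0"
  using cinner_scaleC_right[of y 0 0] by simp

lemma cinner_sum_left: "cinner (sum f F) (y::'a::chilbert_space) = (\<Sum>i\<in>F. cinner (f i) y)"
  by (induction F rule: infinite_finite_induct) (auto simp: cinner_add_left)

lemma Re_cinner_self: "(norm x)\<^sup>2 = Re (cinner x (x::'a::chilbert_space))"
  by (simp add: cinner_self)

lemma Re_cinner_commute: "Re (cinner x y) = Re (cinner y (x::'a::chilbert_space))"
  using cinner_commute[of x y] by simp

lemma norm_sq_add: "(norm (x + y))\<^sup>2 = (norm x)\<^sup>2 + (norm y)\<^sup>2 + 2 * Re (cinner x (y::'a::chilbert_space))"
  unfolding Re_cinner_self cinner_add_left cinner_add_right using Re_cinner_commute[of y x] by simp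

lemma norm_sq_sub_proj:
  fixes x y :: "'a::chilbert_space"
  assumes "y \<noteq> 0"
  shows "(norm (x - (cinner x y / (norm y)\<^sup>2) *\<^sub>C y))\<^sup>2 = (norm x)\<^sup>2 - (cmod (cinner x y))\<^sup>2 / (norm y)\<^sup>2"
proof -
  define c where "c = cinner x y / (norm y)\<^sup>2"
  have n: "norm y \<noteq> 0" using assms by simp
  have "(norm (x + (-c) *\<^sub>C y))\<^sup>2
      = (norm x)\<^sup>2 + (cmod c)\<^sup>2 * (norm y)\<^sup>2 + 2 * Re (- cnj c * cinner x y)"
    unfolding norm_sq_add cinner_scaleC_right norm_scaleC by (simp add: power_mult_distrib)
  also have "cnj c * cinner x y = (cmod (cinner x y))\<^sup>2 / (norm y)\<^sup>2"
    using complex_norm_square[of "cinner x y"] by (simp add: c_def mult.commute)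
  then have "Re (- cnj c * cinner x y) = - ((cmod (cinner x y))\<^sup>2 / (norm y)\<^sup>2)"
    by (metis Re_complex_of_real mult_minus_left of_real_divide of_real_minus of_real_power)
  also have "(cmod c)\<^sup>2 * (norm y)\<^sup>2 = (cmod (cinner x y))\<^sup>2 / (norm y)\<^sup>2"
    using n by (simp add: c_def norm_divide norm_power power_divide) (simp add: power2_eq_square power4_eq_xxxx)
  finally have "(norm (x + (-c) *\<^sub>C y))\<^sup>2 = (norm x)\<^sup>2 - (cmod (cinner x y))\<^sup>2 / (norm y)\<^sup>2"
    by simp
  moreover have "(-c) *\<^sub>C y = - (c *\<^sub>C y)"
    by (metis mult_minus1 scaleC_minus1 scaleC_scaleC)
  ultimately show ?thesis by (simp add: c_def)
qed

lemma cinner_Cauchy_Schwarz: "cmod (cinner x y) \<le> norm x * norm (y::'a::chilbert_space)"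
proof (cases "y = 0")
  case False
  have "0 \<le> (norm x)\<^sup>2 - (cmod (cinner x y))\<^sup>2 / (norm y)\<^sup>2"
    unfolding norm_sq_sub_proj[OF False, symmetric] by simp
  then have "(cmod (cinner x y))\<^sup>2 \<le> (norm x * norm y)\<^sup>2"
    using False by (simp add: field_simps power_mult_distrib)
  then show ?thesis by (rule power2_le_imp_le) simp
qed simp

lemma parallelogram: 
  "(norm (x - y))\<^sup>2 = 2 * (norm x)\<^sup>2 + 2 * (norm y)\<^sup>2 - (norm (x + (y::'a::chilbert_space)))\<^sup>2"
  using norm_sq_add[of x y] norm_sq_add[of x "-y"] by (simp add: cinner_minus_right)

lemma cinner_ext: "(\<And>x. cinner x y = cinner x z) \<Longrightarrow> y = (z::'a::chilbert_space)"
proof -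
  assume "\<And>x. cinner x y = cinner x z"
  then have "cinner (y - z) (y - z) = 0" by (simp add: cinner_diff_right)
  then show "y = z" by (simp add: cinner_self)
qed

lemma Riesz:
  fixes f :: "'a::chilbert_space \<Rightarrow> complex"
  assumes "clinear f" and bd: "\<And>x. norm (f x) \<le> K * norm x"
  shows "\<exists>z. \<forall>x. f x = cinner x z"
proof (cases "\<forall>x. f x = 0")
  case True
  then show ?thesis by (intro exI[of _ 0]) simp
next
  case False
  have add: "f (x + y) = f x + f y" for x y by (rule clinear_add[OF assms(1)])
  have scl: "f (c *\<^sub>C x) = c * f x" for c x
    using clinear_scaleC[OF assms(1)] by (simp add: scaleC_complex_def)
  have sclR: "f (r *\<^sub>R x) = r * f x" for r x by (simp add: scaleR_scaleC scl)
  have neg: "f (- x) = - f x" for x using sclR[of "-1" x] by simp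
  have diff: "f (x - y) = f x - f y" for x y using add[of x "-y"] by (simp add: neg)
  have blf: "bounded_linear f"
    by (rule bounded_linear_intro[where K=K])
      (use bd in \<open>auto simp: add sclR scaleR_conv_of_real mult.commute\<close>)
  from False obtain u0 where "f u0 \<noteq> 0" by blast
  then have u: "f ((1 / f u0) *\<^sub>C u0) = 1" by (simp add: scl)
  define S where "S = norm ` {x. f x = 1}"
  define d where "d = Inf S"
  have S_ne: "S \<noteq> {}" using u by (auto simp: S_def)
  have bdd: "bdd_below S" by (auto simp: S_def intro!: bdd_belowI[of _ 0])
  have d_le: "d \<le> norm x" if "f x = 1" for x
    unfolding d_def using that bdd by (intro cInf_lower) (auto simp: S_def)
  have d0: "d \<ge> 0" unfolding d_def using S_ne by (intro cInf_greatest) (auto simp: S_def)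
  have "\<exists>x. f x = 1 \<and> norm x < d + 1 / real (Suc n)" for n
  proof -
    have "Inf S < d + 1 / real (Suc n)" by (simp add: d_def)
    then obtain s where "s \<in> S" "s < d + 1 / real (Suc n)"
      using cInf_less_iff[OF S_ne bdd] by blast
    then show ?thesis by (auto simp: S_def)
  qed
  then obtain k where k1: "\<And>n. f (k n) = 1" and k2: "\<And>n. norm (k n) < d + 1 / real (Suc n)"
    by metis
  have nk: "(\<lambda>n. norm (k n)) \<longlonglongrightarrow> d"
  proof (rule tendsto_sandwich)
    show "\<forall>\<^sub>F n in sequentially. d \<le> norm (k n)" using d_le k1 by simp
    show "\<forall>\<^sub>F n in sequentially. norm (k n) \<le> d + 1 / real (Suc n)"
      using k2 by (simp add: less_imp_le)
    show "(\<lambda>n. d + 1 / real (Suc n)) \<longlonglongrightarrow> d"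
      using tendsto_add[OF tendsto_const LIMSEQ_inverse_real_of_nat, of d]
      by (simp add: inverse_eq_divide)
  qed simp
  have aux: "a < q" if "a \<le> 2 * b + 2 * c" "b < q / 4" "c < q / 4" for a b c q :: real
    using that by linarith
  have par: "(dist (k m) (k n))\<^sup>2 \<le> 2 * ((norm (k m))\<^sup>2 - d\<^sup>2) + 2 * ((norm (k n))\<^sup>2 - d\<^sup>2)" for m n
  proof -
    have "f ((1/2) *\<^sub>R (k m + k n)) = 1" by (simp add: sclR add k1)
    from d_le[OF this] have "2 * d \<le> norm (k m + k n)" by simp
    then have "(2 * d)\<^sup>2 \<le> (norm (k m + k n))\<^sup>2" using d0 by (intro power_mono) auto
    then show ?thesis using parallelogram[of "k m" "k n"] by (simp add: dist_norm power_mult_distrib)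
  qed
  have lim0: "(\<lambda>n. (norm (k n))\<^sup>2 - d\<^sup>2) \<longlonglongrightarrow> 0"
    using tendsto_diff[OF tendsto_power[OF nk, of 2] tendsto_const[of "d\<^sup>2"]] by simp
  have "Cauchy k"
  proof (rule metric_CauchyI)
    fix e :: real assume e: "e > 0"
    then have "e\<^sup>2 / 4 > 0" by simp
    from order_tendstoD(2)[OF lim0 this] obtain M where
      M: "\<And>n. n \<ge> M \<Longrightarrow> (norm (k n))\<^sup>2 - d\<^sup>2 < e\<^sup>2 / 4"
      unfolding eventually_sequentially by blast
    show "\<exists>M. \<forall>m\<ge>M. \<forall>n\<ge>M. dist (k m) (k n) < e"
    proof (intro exI[of _ M] allI impI)
      fix m n assume "m \<ge> M" "n \<ge> M"
      then have "(dist (k m) (k n))\<^sup>2 < e\<^sup>2"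
        by (rule aux[OF par M M])
      then show "dist (k m) (k n) < e" using e by (simp add: power2_less_imp_less)
    qed
  qed
  then obtain z where z: "k \<longlonglongrightarrow> z" using Cauchy_convergent convergent_def by blast
  have "(\<lambda>n. f (k n)) \<longlonglongrightarrow> f z" by (rule bounded_linear.tendsto[OF blf z])
  then have fz: "f z = 1" by (simp add: k1 LIMSEQ_const_iff)
  have nz: "norm z = d" using tendsto_norm[OF z] nk LIMSEQ_unique by blast
  have z0: "z \<noteq> 0" using fz sclR[of 0 0] by auto
  have orth: "cinner z h = 0" if h: "f h = 0" for h
  proof (cases "h = 0")
    case False
    have "f (z - (cinner z h / (norm h)\<^sup>2) *\<^sub>C h) = 1" by (simp add: diff scl h fz)
    from d_le[OF this] have "d\<^sup>2 \<le> (norm (z - (cinner z h / (norm h)\<^sup>2) *\<^sub>C h))\<^sup>2"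
      using d0 by (intro power_mono) auto
    then have "(cmod (cinner z h))\<^sup>2 / (norm h)\<^sup>2 \<le> 0"
      unfolding norm_sq_sub_proj[OF False] nz by simp
    then show ?thesis using False by (simp add: divide_le_0_iff)
  qed simp
  show ?thesis
  proof (intro exI allI)
    fix x
    have "f (x - f x *\<^sub>C z) = 0" by (simp add: diff scl fz)
    from orth[OF this] have "cinner (x - f x *\<^sub>C z) z = 0"
      by (metis cinner_commute complex_cnj_zero)
    then have "cinner x z = f x * (norm z)\<^sup>2"
      by (simp add: cinner_diff_left cinner_scaleC_left cinner_self)
    then show "f x = cinner x ((1 / (norm z)\<^sup>2) *\<^sub>C z)"
      using z0 by (simp add: cinner_scaleC_right)
  qed
qed

lemma adjoint_op_ex1:
  fixes A :: "'h::chilbert_space \<Rightarrow>\<^sub>L 'h"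
  assumes "clinear (blinfun_apply A)"
  shows "\<exists>!B :: 'h \<Rightarrow>\<^sub>L 'h. \<forall>x y. cinner (A x) y = cinner x (B y)"
proof -
  have "\<exists>z. \<forall>x. cinner (A x) y = cinner x z" for y
  proof (rule Riesz[where K="norm A * norm y"])
    show "clinear (\<lambda>x. cinner (A x) y)"
      by (rule clinearI) (simp_all add: clinear_add[OF assms] clinear_scaleC[OF assms]
          cinner_add_left cinner_scaleC_left scaleC_complex_def blinfun.add_right)
    fix x
    have "cmod (cinner (A x) y) \<le> norm (A x) * norm y" by (rule cinner_Cauchy_Schwarz)
    also have "\<dots> \<le> norm A * norm x * norm y" by (intro mult_right_mono norm_blinfun) simp
    finally show "cmod (cinner (A x) y) \<le> norm A * norm y * norm x" by (simp add: mult_ac)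
  qed
  then obtain b where b: "\<And>x y. cinner (A x) y = cinner x (b y)" by metis
  have "bounded_linear b"
  proof (rule bounded_linear_intro[where K="norm A"])
    show "b (x + y) = b x + b y" for x y
      by (rule cinner_ext) (simp add: b[symmetric] cinner_add_right)
    show "b (r *\<^sub>R x) = r *\<^sub>R b x" for r x
      by (rule cinner_ext) (simp add: b[symmetric] scaleR_scaleC cinner_scaleC_right)
    fix y
    have "(norm (b y))\<^sup>2 = cmod (cinner (b y) (b y))" by (simp add: cinner_self norm_power)
    also have "\<dots> = cmod (cinner (A (b y)) y)" by (simp add: b)
    also have "\<dots> \<le> norm (A (b y)) * norm y" by (rule cinner_Cauchy_Schwarz)
    also have "\<dots> \<le> norm A * norm (b y) * norm y" by (intro mult_right_mono norm_blinfun) simp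
    finally have "norm (b y) * norm (b y) \<le> (norm y * norm A) * norm (b y)"
      by (simp add: power2_eq_square mult_ac)
    then show "norm (b y) \<le> norm y * norm A"
      by (cases "b y = 0") (auto simp: mult_le_cancel_right)
  qed
  then have "\<forall>x y. cinner (A x) y = cinner x (Blinfun b y)"
    by (simp add: bounded_linear_Blinfun_apply b)
  then show ?thesis
  proof (rule ex1I)
    fix B :: "'h \<Rightarrow>\<^sub>L 'h"
    assume B: "\<forall>x y. cinner (A x) y = cinner x (B y)"
    show "B = Blinfun b"
    proof (rule blinfun_eqI)
      fix y
      have "B y = b y" by (rule cinner_ext) (simp add: b[symmetric] B)
      then show "B y = Blinfun b y"
        by (simp add: bounded_linear_Blinfun_apply[OF \<open>bounded_linear b\<close>])
    qed
  qed
qed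

lemma cinner_adjoint_op:
  assumes "clinear (blinfun_apply A)"
  shows "cinner (A x) y = cinner x (adjoint_op A y)"
  using theI'[OF adjoint_op_ex1[OF assms]] unfolding adjoint_op_def by blast


lemma cinner_adjoint_op_left:
  assumes "clinear (blinfun_apply A)"
  shows "cinner (adjoint_op A x) y = cinner x (A y)"
  by (metis assms cinner_adjoint_op cinner_commute)

lemma adjoint_op_unique:
  fixes A B :: "'h::chilbert_space \<Rightarrow>\<^sub>L 'h"
  assumes "clinear (blinfun_apply A)" "\<And>x y. cinner (A x) y = cinner x (B y)"
  shows "adjoint_op A = B"
  by (rule blinfun_eqI, rule cinner_ext) (simp add: assms cinner_adjoint_op[symmetric])

lemma clinear_blinfun_add:
  "clinear (blinfun_apply A) \<Longrightarrow> clinear (blinfun_apply B) \<Longrightarrow> clinear (blinfun_apply (A + B))"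
  by (rule clinearI)
    (simp_all add: plus_blinfun.rep_eq clinear_add clinear_scaleC scaleC_add_right)

lemma clinear_blinfun_scaleC:
  "clinear (blinfun_apply A) \<Longrightarrow> clinear (blinfun_apply (c *\<^sub>C A))"
  by (rule clinearI)
    (simp_all add: scaleC_blinfun.rep_eq clinear_add clinear_scaleC scaleC_add_right
      scaleC_scaleC mult.commute)

lemma adjoint_op_add:
  assumes "clinear (blinfun_apply A)" "clinear (blinfun_apply B)"
  shows "adjoint_op (A + B) = adjoint_op A + adjoint_op B"
  by (rule adjoint_op_unique[OF clinear_blinfun_add[OF assms]])
    (simp add: plus_blinfun.rep_eq cinner_add_left cinner_add_right cinner_adjoint_op assms)

lemma adjoint_op_scaleC:
  assumes "clinear (blinfun_apply A)"
  shows "adjoint_op (c *\<^sub>C A) = cnj c *\<^sub>C adjoint_op A"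
  by (rule adjoint_op_unique[OF clinear_blinfun_scaleC[OF assms]])
    (simp add: scaleC_blinfun.rep_eq cinner_scaleC_left cinner_scaleC_right cinner_adjoint_op assms)

lemma clinear_adjoint_op:
  assumes "clinear (blinfun_apply A)"
  shows "clinear (blinfun_apply (adjoint_op A))"
  by (intro clinearI cinner_ext)
    (simp_all add: cinner_adjoint_op[OF assms, symmetric] cinner_add_right cinner_scaleC_right)

lemma adjoint_op_comp_scaleC:
  assumes "clinear (blinfun_apply A)"
  shows "adjoint_op (c *\<^sub>C A) o\<^sub>L (c *\<^sub>C A) = (cmod c)\<^sup>2 *\<^sub>R (adjoint_op A o\<^sub>L A)"
proof (rule blinfun_eqI)
  fix h
  have "cnj c * c = complex_of_real ((cmod c)\<^sup>2)"
    using complex_norm_square[of c] by (simp add: mult.commute)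
  then show "(adjoint_op (c *\<^sub>C A) o\<^sub>L (c *\<^sub>C A)) h = ((cmod c)\<^sup>2 *\<^sub>R (adjoint_op A o\<^sub>L A)) h"
    by (simp only: adjoint_op_scaleC[OF assms] blinfun_apply_blinfun_compose scaleC_blinfun.rep_eq
        scaleR_blinfun.rep_eq clinear_scaleC[OF clinear_adjoint_op[OF assms]] scaleC_scaleC scaleR_scaleC)
qed

lemma compact_closure_subset:
  "S \<subseteq> K \<Longrightarrow> compact K \<Longrightarrow> compact (closure (S::'a::real_normed_vector set))"
  using compact_Int_closed[of K "closure S"] closure_minimal[of S K] compact_imp_closed[of K]
  by (simp add: Int_absorb1)

lemma compact_operators_clinear: "A \<in> compact_operators \<Longrightarrow> clinear (blinfun_apply A)"
  by (simp add: compact_operators_def)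

lemma compact_operators_zero: "0 \<in> compact_operators"
proof -
  have "blinfun_apply (0 :: 'a \<Rightarrow>\<^sub>L 'a) ` cball 0 1 \<subseteq> {0}" by auto
  then have "compact (closure (blinfun_apply (0 :: 'a \<Rightarrow>\<^sub>L 'a) ` cball 0 1))"
    by (rule compact_closure_subset) simp
  moreover have "clinear (blinfun_apply (0 :: 'a \<Rightarrow>\<^sub>L 'a))"
    using complex_vector.scale_zero_right by (intro clinearI) auto
  ultimately show ?thesis by (simp add: compact_operators_def)
qed

lemma compact_operators_add:
  assumes "A \<in> compact_operators" "B \<in> compact_operators"
  shows "A + B \<in> compact_operators"
proof -
  let ?CA = "closure (blinfun_apply A ` cball 0 1)" and ?CB = "closure (blinfun_apply B ` cball 0 1)"
  have "compact {x + y | x y. x \<in> ?CA \<and> y \<in> ?CB}"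
    by (rule compact_sums) (use assms in \<open>auto simp: compact_operators_def\<close>)
  moreover have "blinfun_apply (A + B) ` cball 0 1 \<subseteq> {x + y | x y. x \<in> ?CA \<and> y \<in> ?CB}"
  proof
    fix z assume "z \<in> blinfun_apply (A + B) ` cball 0 1"
    then obtain h where h: "h \<in> cball 0 1" "z = A h + B h" by (auto simp: plus_blinfun.rep_eq)
    have "A h \<in> ?CA" "B h \<in> ?CB" using h(1) by (auto intro!: subsetD[OF closure_subset])
    with h(2) show "z \<in> {x + y | x y. x \<in> ?CA \<and> y \<in> ?CB}" by blast
  qed
  ultimately show ?thesis
    using assms by (auto simp: compact_operators_def clinear_blinfun_add intro: compact_closure_subset)
qed

lemma compact_operators_scaleC:
  assumes "A \<in> compact_operators"
  shows "c *\<^sub>C A \<in> compact_operators"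
proof -
  let ?CA = "closure (blinfun_apply A ` cball 0 1)"
  have "compact ((\<lambda>x. c *\<^sub>C x) ` ?CA)"
    using assms linear_continuous_on[OF bounded_linear_scaleC]
    by (intro compact_continuous_image) (auto simp: compact_operators_def)
  moreover have "blinfun_apply (c *\<^sub>C A) ` cball 0 1 \<subseteq> (\<lambda>x. c *\<^sub>C x) ` ?CA"
  proof
    fix z assume "z \<in> blinfun_apply (c *\<^sub>C A) ` cball 0 1"
    then obtain h where h: "h \<in> cball 0 1" "z = c *\<^sub>C A h" by (auto simp: scaleC_blinfun.rep_eq)
    have "A h \<in> ?CA" using h(1) by (auto intro!: subsetD[OF closure_subset])
    with h(2) show "z \<in> (\<lambda>x. c *\<^sub>C x) ` ?CA" by blast
  qed
  ultimately show ?thesis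
    using assms by (auto simp: compact_operators_def clinear_blinfun_scaleC intro: compact_closure_subset)
qed

section \<open>The standard Hilbert module over the compact operators\<close>

lemma gram_sum_self:
  fixes x :: "nat \<Rightarrow> 'h::chilbert_space \<Rightarrow>\<^sub>L 'h"
  assumes "\<And>j. clinear (blinfun_apply (x j))"
  shows "L2_set (\<lambda>j. norm (x j h)) F \<le> sqrt (norm (\<Sum>j\<in>F. adjoint_op (x j) o\<^sub>L x j)) * norm h"
proof -
  let ?S = "\<Sum>j\<in>F. adjoint_op (x j) o\<^sub>L x j"
  have "complex_of_real (\<Sum>j\<in>F. (norm (x j h))\<^sup>2) = cinner (?S h) h"
    by (simp add: blinfun.sum_left cinner_sum_left cinner_adjoint_op_left assms cinner_self)
  then have "(\<Sum>j\<in>F. (norm (x j h))\<^sup>2) = Re (cinner (?S h) h)"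
    by (metis Re_complex_of_real)
  also have "\<dots> \<le> cmod (cinner (?S h) h)" by (rule complex_Re_le_cmod)
  also have "\<dots> \<le> norm (?S h) * norm h" by (rule cinner_Cauchy_Schwarz)
  also have "\<dots> \<le> norm ?S * norm h * norm h" by (intro mult_right_mono norm_blinfun) simp
  finally have "L2_set (\<lambda>j. norm (x j h)) F \<le> sqrt (norm ?S * (norm h)\<^sup>2)"
    unfolding L2_set_def by (simp add: power2_eq_square mult.assoc)
  then show ?thesis by (simp add: real_sqrt_mult)
qed

lemma gram_sum_Cauchy_Schwarz:
  fixes x y :: "nat \<Rightarrow> 'h::chilbert_space \<Rightarrow>\<^sub>L 'h"
  assumes x: "\<And>j. clinear (blinfun_apply (x j))" and y: "\<And>j. clinear (blinfun_apply (y j))"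
  shows "norm (\<Sum>j\<in>F. adjoint_op (y j) o\<^sub>L x j) \<le>
    sqrt (norm (\<Sum>j\<in>F. adjoint_op (x j) o\<^sub>L x j)) * sqrt (norm (\<Sum>j\<in>F. adjoint_op (y j) o\<^sub>L y j))"
    (is "norm ?S \<le> sqrt ?X * sqrt ?Y")
proof (rule norm_blinfun_bound)
  fix h
  define v where "v = ?S h"
  have "(norm v)\<^sup>2 = cmod (cinner (?S h) v)" by (simp add: cinner_self norm_power v_def)
  also have "\<dots> = cmod (\<Sum>j\<in>F. cinner (x j h) (y j v))"
    by (simp add: blinfun.sum_left cinner_sum_left cinner_adjoint_op_left y)
  also have "\<dots> \<le> (\<Sum>j\<in>F. \<bar>norm (x j h)\<bar> * \<bar>norm (y j v)\<bar>)"
    by (intro sum_norm_le) (simp add: cinner_Cauchy_Schwarz)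
  also have "\<dots> \<le> L2_set (\<lambda>j. norm (x j h)) F * L2_set (\<lambda>j. norm (y j v)) F"
    by (rule L2_set_mult_ineq)
  also have "\<dots> \<le> (sqrt ?X * norm h) * (sqrt ?Y * norm v)"
    by (intro mult_mono gram_sum_self x y) auto
  finally have "norm v * norm v \<le> (sqrt ?X * sqrt ?Y * norm h) * norm v"
    by (simp add: power2_eq_square mult_ac)
  then have "norm v \<le> sqrt ?X * sqrt ?Y * norm h"
    by (cases "v = 0") (auto simp: mult_le_cancel_right)
  then show "norm (?S h) \<le> sqrt ?X * sqrt ?Y * norm h" by (simp add: v_def)
qed simp

lemma gram_summable:
  fixes x y :: "nat \<Rightarrow> 'h::chilbert_space \<Rightarrow>\<^sub>L 'h"
  assumes x: "\<And>j. clinear (blinfun_apply (x j))" "summable (\<lambda>j. adjoint_op (x j) o\<^sub>L x j)"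
    and y: "\<And>j. clinear (blinfun_apply (y j))" "summable (\<lambda>j. adjoint_op (y j) o\<^sub>L y j)"
  shows "summable (\<lambda>j. adjoint_op (y j) o\<^sub>L x j)"
  unfolding summable_Cauchy
proof (intro allI impI)
  fix e :: real assume e: "e > 0"
  obtain M1 where M1: "\<And>m n. m \<ge> M1 \<Longrightarrow> norm (\<Sum>j=m..<n. adjoint_op (x j) o\<^sub>L x j) < e"
    using x(2) e unfolding summable_Cauchy by blast
  obtain M2 where M2: "\<And>m n. m \<ge> M2 \<Longrightarrow> norm (\<Sum>j=m..<n. adjoint_op (y j) o\<^sub>L y j) < e"
    using y(2) e unfolding summable_Cauchy by blast
  show "\<exists>N. \<forall>m\<ge>N. \<forall>n. norm (\<Sum>j=m..<n. adjoint_op (y j) o\<^sub>L x j) < e"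
  proof (intro exI[of _ "max M1 M2"] allI impI)
    fix m n assume m: "max M1 M2 \<le> m"
    have "norm (\<Sum>j=m..<n. adjoint_op (y j) o\<^sub>L x j) \<le>
        sqrt (norm (\<Sum>j=m..<n. adjoint_op (x j) o\<^sub>L x j)) * sqrt (norm (\<Sum>j=m..<n. adjoint_op (y j) o\<^sub>L y j))"
      by (rule gram_sum_Cauchy_Schwarz[OF x(1) y(1)])
    also have "\<dots> < sqrt e * sqrt e"
      by (intro mult_strict_mono' real_sqrt_less_mono M1 M2) (use m in auto)
    finally show "norm (\<Sum>j=m..<n. adjoint_op (y j) o\<^sub>L x j) < e" using e by simp
  qed
qed

typedef (overloaded) ('h::chilbert_space) std_module =
  "{x :: nat \<Rightarrow> 'h \<Rightarrow>\<^sub>L 'h. (\<forall>j. x j \<in> compact_operators) \<and>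
     summable (\<lambda>j. adjoint_op (x j) o\<^sub>L x j)}"
  morphisms mod_nth Abs_std_module
proof (intro exI CollectI conjI allI)
  show "(0 :: 'h \<Rightarrow>\<^sub>L 'h) \<in> compact_operators" by (rule compact_operators_zero)
  show "summable (\<lambda>j::nat. adjoint_op 0 o\<^sub>L (0 :: 'h \<Rightarrow>\<^sub>L 'h))" by simp
qed

setup_lifting type_definition_std_module

text \<open>The terms of the series are positive, so ordered convergence in operator norm coincides with
  unconditional convergence.\<close>

definition mod_inner :: "'h::chilbert_space std_module \<Rightarrow> 'h std_module \<Rightarrow> 'h \<Rightarrow>\<^sub>L 'h" where
  "mod_inner x y = (\<Sum>j. adjoint_op (mod_nth y j) o\<^sub>L mod_nth x j)"

lemma mod_nth_compact: "mod_nth x j \<in> compact_operators"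
  using mod_nth[of x] by simp

lemma mod_nth_clinear: "clinear (blinfun_apply (mod_nth x j))"
  by (rule compact_operators_clinear[OF mod_nth_compact])

lemma mod_inner_summable: "summable (\<lambda>j. adjoint_op (mod_nth y j) o\<^sub>L mod_nth x j)"
  using mod_nth[of x] mod_nth[of y] by (blast intro: mod_nth_clinear gram_summable[of "mod_nth x" "mod_nth y"])

lemma mod_inner_Cauchy_Schwarz:
  "norm (mod_inner x y) \<le> sqrt (norm (mod_inner x x)) * sqrt (norm (mod_inner y y))"
proof (rule LIMSEQ_le)
  have *: "(\<lambda>n. \<Sum>j<n. adjoint_op (mod_nth y j) o\<^sub>L mod_nth x j) \<longlonglongrightarrow> mod_inner x y" for x y :: "'a std_module"
    unfolding mod_inner_def by (rule summable_LIMSEQ[OF mod_inner_summable])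
  show "(\<lambda>n. norm (\<Sum>j<n. adjoint_op (mod_nth y j) o\<^sub>L mod_nth x j)) \<longlonglongrightarrow> norm (mod_inner x y)"
    by (intro tendsto_norm *)
  show "(\<lambda>n. sqrt (norm (\<Sum>j<n. adjoint_op (mod_nth x j) o\<^sub>L mod_nth x j)) *
           sqrt (norm (\<Sum>j<n. adjoint_op (mod_nth y j) o\<^sub>L mod_nth y j)))
        \<longlonglongrightarrow> sqrt (norm (mod_inner x x)) * sqrt (norm (mod_inner y y))"
    by (intro tendsto_mult tendsto_real_sqrt tendsto_norm *)
  show "\<exists>N. \<forall>n\<ge>N. norm (\<Sum>j<n. adjoint_op (mod_nth y j) o\<^sub>L mod_nth x j) \<le>
      sqrt (norm (\<Sum>j<n. adjoint_op (mod_nth x j) o\<^sub>L mod_nth x j)) *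
      sqrt (norm (\<Sum>j<n. adjoint_op (mod_nth y j) o\<^sub>L mod_nth y j))"
    by (intro exI allI impI gram_sum_Cauchy_Schwarz mod_nth_clinear)
qed

instantiation std_module :: (chilbert_space) complex_normed_vector
begin

lift_definition zero_std_module :: "'a std_module" is "\<lambda>_. 0"
  by (simp add: compact_operators_zero)

lift_definition plus_std_module :: "'a std_module \<Rightarrow> 'a std_module \<Rightarrow> 'a std_module"
  is "\<lambda>x y j. x j + y j"
proof (intro conjI allI; elim conjE)
  fix x y :: "nat \<Rightarrow> 'a \<Rightarrow>\<^sub>L 'a"
  assume x: "\<forall>j. x j \<in> compact_operators" and y: "\<forall>j. y j \<in> compact_operators"
  show "x j + y j \<in> compact_operators" for j using x y by (simp add: compact_operators_add)
  assume sx: "summable (\<lambda>j. adjoint_op (x j) o\<^sub>L x j)" and sy: "summable (\<lambda>j. adjoint_op (y j) o\<^sub>L y j)"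
  have cx: "clinear (blinfun_apply (x j))" and cy: "clinear (blinfun_apply (y j))" for j
    using x y by (auto intro: compact_operators_clinear)
  have "summable (\<lambda>j. ((adjoint_op (x j) o\<^sub>L x j) + (adjoint_op (y j) o\<^sub>L y j)) +
      ((adjoint_op (x j) o\<^sub>L y j) + (adjoint_op (y j) o\<^sub>L x j)))"
    by (rule summable_add[OF summable_add[OF sx sy]
          summable_add[OF gram_summable[OF cy sy cx sx] gram_summable[OF cx sx cy sy]]])
  also have "(\<lambda>j. ((adjoint_op (x j) o\<^sub>L x j) + (adjoint_op (y j) o\<^sub>L y j)) +
      ((adjoint_op (x j) o\<^sub>L y j) + (adjoint_op (y j) o\<^sub>L x j))) =
      (\<lambda>j. adjoint_op (x j + y j) o\<^sub>L (x j + y j))"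
    by (simp add: adjoint_op_add cx cy bounded_bilinear.add_left[OF bounded_bilinear_blinfun_compose]
        bounded_bilinear.add_right[OF bounded_bilinear_blinfun_compose] add_ac)
  finally show "summable (\<lambda>j. adjoint_op (x j + y j) o\<^sub>L (x j + y j))" .
qed

lift_definition scaleC_std_module :: "complex \<Rightarrow> 'a std_module \<Rightarrow> 'a std_module"
  is "\<lambda>c x j. c *\<^sub>C x j"
proof (intro conjI allI; elim conjE)
  fix c and x :: "nat \<Rightarrow> 'a \<Rightarrow>\<^sub>L 'a"
  assume x: "\<forall>j. x j \<in> compact_operators"
  show "c *\<^sub>C x j \<in> compact_operators" for j using x by (simp add: compact_operators_scaleC)
  assume sx: "summable (\<lambda>j. adjoint_op (x j) o\<^sub>L x j)"
  have cx: "clinear (blinfun_apply (x j))" for j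
    using x by (auto intro: compact_operators_clinear)
  show "summable (\<lambda>j. adjoint_op (c *\<^sub>C x j) o\<^sub>L (c *\<^sub>C x j))"
    unfolding adjoint_op_comp_scaleC[OF cx] by (rule summable_scaleR_right[OF sx])
qed

definition uminus_std_module :: "'a std_module \<Rightarrow> 'a std_module" where
  "uminus_std_module x = (-1) *\<^sub>C x"

definition minus_std_module :: "'a std_module \<Rightarrow> 'a std_module \<Rightarrow> 'a std_module" where
  "minus_std_module x y = x + (- y)"

definition scaleR_std_module :: "real \<Rightarrow> 'a std_module \<Rightarrow> 'a std_module" where
  "scaleR_std_module r x = complex_of_real r *\<^sub>C x"

definition norm_std_module :: "'a std_module \<Rightarrow> real" where
  "norm_std_module x = sqrt (norm (mod_inner x x))"

definition sgn_std_module :: "'a std_module \<Rightarrow> 'a std_module" where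
  "sgn_std_module x = inverse (norm x) *\<^sub>R x"

definition dist_std_module :: "'a std_module \<Rightarrow> 'a std_module \<Rightarrow> real" where
  "dist_std_module x y = norm (x - y)"

definition uniformity_std_module :: "('a std_module \<times> 'a std_module) filter" where
  "uniformity_std_module = (INF e\<in>{0<..}. principal {(x, y). dist x y < e})"

definition open_std_module :: "'a std_module set \<Rightarrow> bool" where
  "open_std_module U \<longleftrightarrow> (\<forall>x\<in>U. \<forall>\<^sub>F (x', y) in uniformity. x' = x \<longrightarrow> y \<in> U)"

lemma mod_inner_add_self:
  "mod_inner (x + y) (x + y) = (mod_inner x x + mod_inner y y) + (mod_inner y x + mod_inner x y)"
proof -
  have "mod_inner (x + y) (x + y) =
    (\<Sum>j. ((adjoint_op (mod_nth x j) o\<^sub>L mod_nth x j) + (adjoint_op (mod_nth y j) o\<^sub>L mod_nth y j)) +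
      ((adjoint_op (mod_nth x j) o\<^sub>L mod_nth y j) + (adjoint_op (mod_nth y j) o\<^sub>L mod_nth x j)))"
    unfolding mod_inner_def
    by (simp add: plus_std_module.rep_eq adjoint_op_add mod_nth_clinear
        bounded_bilinear.add_left[OF bounded_bilinear_blinfun_compose]
        bounded_bilinear.add_right[OF bounded_bilinear_blinfun_compose] add_ac)
  also have "\<dots> = (mod_inner x x + mod_inner y y) + (mod_inner y x + mod_inner x y)"
    unfolding mod_inner_def
    by (simp add: suminf_add[symmetric] summable_add mod_inner_summable)
  finally show ?thesis .
qed

lemma mod_inner_scaleC_self:
  "mod_inner (c *\<^sub>C x) (c *\<^sub>C x) = (cmod c)\<^sup>2 *\<^sub>R mod_inner x x"
  unfolding mod_inner_def scaleC_std_module.rep_eq adjoint_op_comp_scaleC[OF mod_nth_clinear]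
  by (rule suminf_scaleR_right[OF mod_inner_summable, symmetric])

lemma mod_inner_self_eq_0:
  assumes "mod_inner x x = 0"
  shows "x = 0"
proof -
  have "mod_nth x i h = 0" for i h
  proof -
    have bl: "bounded_linear (\<lambda>A :: 'a \<Rightarrow>\<^sub>L 'a. Re (cinner (A h) h))"
    proof (rule bounded_linear_intro[where K="norm h * norm h"])
      fix A :: "'a \<Rightarrow>\<^sub>L 'a"
      have "\<bar>Re (cinner (A h) h)\<bar> \<le> cmod (cinner (A h) h)" by (rule abs_Re_le_cmod)
      also have "\<dots> \<le> norm (A h) * norm h" by (rule cinner_Cauchy_Schwarz)
      also have "\<dots> \<le> norm A * norm h * norm h" by (intro mult_right_mono norm_blinfun) simp
      finally show "norm (Re (cinner (A h) h)) \<le> norm A * (norm h * norm h)" by (simp add: mult_ac)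
    qed (simp_all add: plus_blinfun.rep_eq scaleR_blinfun.rep_eq cinner_add_left
        scaleR_scaleC[where 'a='a] cinner_scaleC_left)
    have eq: "Re (cinner ((adjoint_op (mod_nth x j) o\<^sub>L mod_nth x j) h) h) = (norm (mod_nth x j h))\<^sup>2" for j
      by (simp add: cinner_adjoint_op_left mod_nth_clinear cinner_self)
    have "(\<lambda>j. adjoint_op (mod_nth x j) o\<^sub>L mod_nth x j) sums 0"
      using mod_inner_summable[of x x] assms unfolding mod_inner_def by (simp add: sums_iff)
    from bounded_linear.sums[OF bl this] have s: "(\<lambda>j. (norm (mod_nth x j h))\<^sup>2) sums 0"
      by (simp add: eq del: blinfun_apply_blinfun_compose)
    then have "\<forall>j. (norm (mod_nth x j h))\<^sup>2 = 0"
      using suminf_eq_zero_iff[of "\<lambda>j. (norm (mod_nth x j h))\<^sup>2"] by (simp add: sums_iff)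
    then show ?thesis by simp
  qed
  then have "mod_nth x = mod_nth 0"
    by (intro ext blinfun_eqI) (simp add: zero_std_module.rep_eq)
  then show ?thesis by (simp add: mod_nth_inject)
qed

instance
proof
  fix x y z :: "'a std_module" and a b :: complex and r s :: real and U :: "'a std_module set"
  show "x + y + z = x + (y + z)" by transfer (simp add: add_ac)
  show comm: "x + y = y + x" for x y :: "'a std_module" by transfer (simp add: add_ac)
  show zero: "0 + x = x" for x :: "'a std_module" by transfer simp
  have one: "1 *\<^sub>C x = x" for x :: "'a std_module" by transfer (simp add: scaleC_one)
  have addL: "(a + b) *\<^sub>C x = a *\<^sub>C x + b *\<^sub>C x" for a b and x :: "'a std_module"
    by transfer (simp add: scaleC_add_left)
  have addR: "a *\<^sub>C (x + y) = a *\<^sub>C x + a *\<^sub>C y" for a and x y :: "'a std_module"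
    by transfer (simp add: scaleC_add_right)
  have ss: "a *\<^sub>C b *\<^sub>C x = (a * b) *\<^sub>C x" for a b and x :: "'a std_module"
    by transfer (simp add: scaleC_scaleC)
  have z: "0 *\<^sub>C x = 0" for x :: "'a std_module" by transfer simp
  show "- x + x = 0" unfolding uminus_std_module_def using addL[of "-1" 1 x] by (simp add: one z)
  show "x - y = x + - y" by (rule minus_std_module_def)
  show "r *\<^sub>R (x + y) = r *\<^sub>R x + r *\<^sub>R y" by (simp add: scaleR_std_module_def addR)
  show "(r + s) *\<^sub>R x = r *\<^sub>R x + s *\<^sub>R x" by (simp add: scaleR_std_module_def addL)
  show "r *\<^sub>R s *\<^sub>R x = (r * s) *\<^sub>R x" by (simp add: scaleR_std_module_def ss)
  show "1 *\<^sub>R x = x" by (simp add: scaleR_std_module_def one)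
  show "a *\<^sub>C (x + y) = a *\<^sub>C x + a *\<^sub>C y" by (rule addR)
  show "(a + b) *\<^sub>C x = a *\<^sub>C x + b *\<^sub>C x" by (rule addL)
  show "a *\<^sub>C b *\<^sub>C x = (a * b) *\<^sub>C x" by (rule ss)
  show "1 *\<^sub>C x = x" by (rule one)
  show "r *\<^sub>R x = complex_of_real r *\<^sub>C x" by (rule scaleR_std_module_def)
  show "sgn x = inverse (norm x) *\<^sub>R x" by (rule sgn_std_module_def)
  show "dist x y = norm (x - y)" by (rule dist_std_module_def)
  show "uniformity = (INF e\<in>{0<..}. principal {(x :: 'a std_module, y). dist x y < e})"
    by (rule uniformity_std_module_def)
  show "open U = (\<forall>x\<in>U. \<forall>\<^sub>F (x', y) in uniformity. x' = x \<longrightarrow> y \<in> U)"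
    by (rule open_std_module_def)
  show nC: "norm (a *\<^sub>C x) = cmod a * norm x" for a and x :: "'a std_module"
    by (simp add: norm_std_module_def mod_inner_scaleC_self real_sqrt_mult)
  show "norm (r *\<^sub>R x) = \<bar>r\<bar> * norm x" by (simp add: scaleR_std_module_def nC)
  have "norm (0 :: 'a std_module) = 0" using nC[of 0 0] z[of 0] by simp
  moreover have "x = 0" if "norm x = 0"
    using that by (intro mod_inner_self_eq_0) (simp add: norm_std_module_def)
  ultimately show "norm x = 0 \<longleftrightarrow> x = 0" by blast
  have "(norm (x + y))\<^sup>2 = norm (mod_inner (x + y) (x + y))" by (simp add: norm_std_module_def)
  also have "\<dots> \<le> (norm (mod_inner x x) + norm (mod_inner y y)) +
      (norm (mod_inner y x) + norm (mod_inner x y))"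
    unfolding mod_inner_add_self by (intro norm_triangle_le add_mono norm_triangle_ineq)
  also have "\<dots> \<le> ((norm x)\<^sup>2 + (norm y)\<^sup>2) + (norm y * norm x + norm x * norm y)"
    unfolding norm_std_module_def by (intro add_mono mod_inner_Cauchy_Schwarz) simp_all
  also have "\<dots> = (norm x + norm y)\<^sup>2" by (simp add: power2_eq_square algebra_simps)
  finally show "norm (x + y) \<le> norm x + norm y"
    by (rule power2_le_imp_le) (simp add: norm_std_module_def)
qed

end

section \<open>The sequence space\<close>

typedef ell2 = "{x :: nat \<Rightarrow> complex. summable (\<lambda>n. (cmod (x n))\<^sup>2)}"
  morphisms ell2_nth Abs_ell2
  by (intro exI[of _ "\<lambda>_. 0"]) simp

setup_lifting type_definition_ell2

lemma ell2_triangle: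
  assumes "summable (\<lambda>n. (cmod (x n))\<^sup>2)" "summable (\<lambda>n. (cmod (y n))\<^sup>2)"
  shows "summable (\<lambda>n. (cmod (x n + y n))\<^sup>2)"
    and "sqrt (\<Sum>n. (cmod (x n + y n))\<^sup>2) \<le> sqrt (\<Sum>n. (cmod (x n))\<^sup>2) + sqrt (\<Sum>n. (cmod (y n))\<^sup>2)"
proof -
  let ?b = "sqrt (\<Sum>n. (cmod (x n))\<^sup>2) + sqrt (\<Sum>n. (cmod (y n))\<^sup>2)"
  have b0: "?b \<ge> 0" by (simp add: suminf_nonneg assms)
  have bound: "(\<Sum>i<n. (cmod (x i + y i))\<^sup>2) \<le> ?b\<^sup>2" for n
  proof -
    have "L2_set (\<lambda>i. cmod (x i + y i)) {..<n} \<le> L2_set (\<lambda>i. cmod (x i) + cmod (y i)) {..<n}"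
      by (intro L2_set_mono norm_triangle_ineq) simp
    also have "\<dots> \<le> L2_set (\<lambda>i. cmod (x i)) {..<n} + L2_set (\<lambda>i. cmod (y i)) {..<n}"
      by (rule L2_set_triangle_ineq)
    also have "\<dots> \<le> ?b"
      unfolding L2_set_def by (intro add_mono real_sqrt_le_mono sum_le_suminf assms) auto
    finally have "(L2_set (\<lambda>i. cmod (x i + y i)) {..<n})\<^sup>2 \<le> ?b\<^sup>2"
      by (intro power_mono) simp_all
    then show ?thesis by (simp add: L2_set_def sum_nonneg)
  qed
  show s: "summable (\<lambda>n. (cmod (x n + y n))\<^sup>2)"
    by (rule summableI_nonneg_bounded[OF _ bound]) simp
  have "(\<Sum>n. (cmod (x n + y n))\<^sup>2) \<le> ?b\<^sup>2" by (rule suminf_le_const[OF s bound])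
  then show "sqrt (\<Sum>n. (cmod (x n + y n))\<^sup>2) \<le> ?b"
    using b0 by (intro real_le_lsqrt) (auto intro: suminf_nonneg s)
qed

instantiation ell2 :: complex_normed_vector
begin

lift_definition zero_ell2 :: ell2 is "\<lambda>_. 0" by simp

lift_definition plus_ell2 :: "ell2 \<Rightarrow> ell2 \<Rightarrow> ell2" is "\<lambda>x y n. x n + y n"
  by (rule ell2_triangle(1))

lift_definition uminus_ell2 :: "ell2 \<Rightarrow> ell2" is "\<lambda>x n. - x n" by simp

definition minus_ell2 :: "ell2 \<Rightarrow> ell2 \<Rightarrow> ell2" where "minus_ell2 x y = x + (- y)"

lift_definition scaleC_ell2 :: "complex \<Rightarrow> ell2 \<Rightarrow> ell2" is "\<lambda>c x n. c * x n"
  by (simp add: norm_mult power_mult_distrib summable_mult)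

definition scaleR_ell2 :: "real \<Rightarrow> ell2 \<Rightarrow> ell2" where
  "scaleR_ell2 r x = complex_of_real r *\<^sub>C x"

lift_definition norm_ell2 :: "ell2 \<Rightarrow> real" is "\<lambda>x. sqrt (\<Sum>n. (cmod (x n))\<^sup>2)" .

definition sgn_ell2 :: "ell2 \<Rightarrow> ell2" where "sgn_ell2 x = inverse (norm x) *\<^sub>R x"

definition dist_ell2 :: "ell2 \<Rightarrow> ell2 \<Rightarrow> real" where "dist_ell2 x y = norm (x - y)"

definition uniformity_ell2 :: "(ell2 \<times> ell2) filter" where
  "uniformity_ell2 = (INF e\<in>{0<..}. principal {(x, y). dist x y < e})"

definition open_ell2 :: "ell2 set \<Rightarrow> bool" where
  "open_ell2 U \<longleftrightarrow> (\<forall>x\<in>U. \<forall>\<^sub>F (x', y) in uniformity. x' = x \<longrightarrow> y \<in> U)"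

instance
proof
  fix x y z :: ell2 and a b :: complex and r s :: real and U :: "ell2 set"
  show "x + y + z = x + (y + z)" by transfer (simp add: add_ac)
  show "x + y = y + x" by transfer (simp add: add_ac)
  show "0 + x = x" by transfer simp
  show "- x + x = 0" by transfer simp
  show "x - y = x + - y" by (rule minus_ell2_def)
  show "a *\<^sub>C (x + y) = a *\<^sub>C x + a *\<^sub>C y" by transfer (simp add: algebra_simps)
  show "(a + b) *\<^sub>C x = a *\<^sub>C x + b *\<^sub>C x" by transfer (simp add: algebra_simps)
  show "a *\<^sub>C b *\<^sub>C x = (a * b) *\<^sub>C x" by transfer (simp add: algebra_simps)
  show "1 *\<^sub>C x = x" by transfer simp
  show "r *\<^sub>R (x + y) = r *\<^sub>R x + r *\<^sub>R y"
    unfolding scaleR_ell2_def by transfer (simp add: algebra_simps)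
  show "(r + s) *\<^sub>R x = r *\<^sub>R x + s *\<^sub>R x"
    unfolding scaleR_ell2_def by transfer (simp add: algebra_simps)
  show "r *\<^sub>R s *\<^sub>R x = (r * s) *\<^sub>R x"
    unfolding scaleR_ell2_def by transfer (simp add: algebra_simps)
  show "1 *\<^sub>R x = x" unfolding scaleR_ell2_def by transfer simp
  show "r *\<^sub>R x = complex_of_real r *\<^sub>C x" by (rule scaleR_ell2_def)
  show "sgn x = inverse (norm x) *\<^sub>R x" by (rule sgn_ell2_def)
  show "dist x y = norm (x - y)" by (rule dist_ell2_def)
  show "uniformity = (INF e\<in>{0<..}. principal {(x :: ell2, y). dist x y < e})"
    by (rule uniformity_ell2_def)
  show "open U = (\<forall>x\<in>U. \<forall>\<^sub>F (x', y) in uniformity. x' = x \<longrightarrow> y \<in> U)"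
    by (rule open_ell2_def)
  show nC: "norm (a *\<^sub>C x) = cmod a * norm x" for a and x :: ell2
    by transfer (simp add: norm_mult power_mult_distrib suminf_mult real_sqrt_mult)
  show "norm (r *\<^sub>R x) = \<bar>r\<bar> * norm x" by (simp add: scaleR_ell2_def nC)
  show "norm x = 0 \<longleftrightarrow> x = 0" by transfer (auto simp: suminf_eq_zero_iff)
  show "norm (x + y) \<le> norm x + norm y" by transfer (rule ell2_triangle(2))
qed

end

section \<open>Transitivity and supercyclicity\<close>

definition Cstar_transitive :: "('h::chilbert_space std_module \<Rightarrow> 'h std_module) \<Rightarrow> bool" where
  "Cstar_transitive T \<longleftrightarrow>
     (\<forall>W V. openin (top_of_set (sphere 0 1 \<times> sphere 0 1)) W \<and> W \<noteq> {} \<and>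
            openin (top_of_set compact_operators) V \<and> V \<noteq> {} \<longrightarrow>
        (\<exists>n\<ge>1. \<exists>(x, y) \<in> W. mod_inner ((T ^^ n) x) y \<in> V))"

text \<open>The topology of the product type is the one induced by the maximum of the two norms.\<close>

definition norming_pairs :: "('a::complex_normed_vector \<times> ('a \<Rightarrow>\<^sub>L complex)) set" where
  "norming_pairs =
     {(x, f). norm x = 1 \<and> clinear (blinfun_apply f) \<and> norm f = 1 \<and> blinfun_apply f x = 1}"

definition numerically_transitive :: "('a::complex_normed_vector \<Rightarrow> 'a) \<Rightarrow> bool" where
  "numerically_transitive T \<longleftrightarrow>
     (\<forall>U V. openin (top_of_set norming_pairs) U \<and> U \<noteq> {} \<and> open V \<and> V \<noteq> {} \<longrightarrow>
        (\<exists>n. \<exists>(x, f) \<in> U. blinfun_apply f ((T ^^ n) x) \<in> V))"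

definition weak_topology :: "'a::complex_normed_vector topology" where
  "weak_topology =
     topology_generated_by {f -` U | f U. bounded_clinear (f :: 'a \<Rightarrow> complex) \<and> open U}"

text \<open>An \<open>n\<close>-dimensional subspace is given as the span of \<open>n\<close> independent vectors; the library's
  dimension function is \<open>0\<close> on infinite-dimensional subspaces.\<close>

definition weakly_n_supercyclic :: "nat \<Rightarrow> ('a::complex_normed_vector \<Rightarrow> 'a) \<Rightarrow> bool" where
  "weakly_n_supercyclic n T \<longleftrightarrow>
     (\<exists>B. finite B \<and> card B = n \<and> \<not> cdependent B \<and>
        weak_topology closure_of (\<Union>k\<in>{1..}. (T ^^ k) ` cspan B) = UNIV)"

text \<open>The space of \<open>N\<close>-tuples of complex numbers; its points are the functions that are
  \<^const>\<open>undefined\<close> at all indices from \<open>N\<close> on.\<close>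

definition complex_space :: "nat \<Rightarrow> (nat \<Rightarrow> complex) topology" where
  "complex_space N = product_topology (\<lambda>_. euclidean) {..<N}"

definition N_weakly_supercyclic :: "nat \<Rightarrow> ('a::complex_normed_vector \<Rightarrow> 'a) \<Rightarrow> bool" where
  "N_weakly_supercyclic N T \<longleftrightarrow>
     (\<exists>x. \<forall>\<gamma>. continuous_map euclidean (complex_space N) \<gamma> \<and>
             \<gamma> ` UNIV = topspace (complex_space N) \<and> (\<forall>i<N. clinear (\<lambda>z. \<gamma> z i)) \<longrightarrow>
        complex_space N closure_of (\<gamma> ` {c *\<^sub>C (T ^^ n) x | c n. True}) = topspace (complex_space N))"

end

theory Submission
  imports Defs
begin

text \<open>On both spaces the operator is \<open>T\<close>, given by \<open>(T x) j = 2 x (j + 2)\<close> for even \<open>j\<close> and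
  \<open>(T x) j = 0\<close> for odd \<open>j\<close>. A finitely supported sequence is mapped to \<open>0\<close> by \<open>T ^ n\<close> for all
  large \<open>n\<close>, while an entry of size \<open>O(2 ^ (-n))\<close> put at coordinate \<open>k + 2 n\<close>, \<open>k\<close> even, is moved by
  \<open>T ^ n\<close> to an entry of size \<open>O(1)\<close> at coordinate \<open>k\<close>. So an arbitrarily small perturbation of \<open>x\<close>
  prescribes the pairing of \<open>T ^ n x\<close> with \<open>y\<close>. In the module case this needs a coordinate of \<open>y\<close> whose
  adjoint almost fixes the given compact operator on the left, and a small multiple of a finite rank
  projection is first added to \<open>y\<close> for this purpose.

  The odd coordinate functionals vanish on the range of \<open>T\<close>, and they span an infinite-dimensional
  space. One of them keeps \<open>T ^ k M\<close>, \<open>k \<ge> 1\<close>, inside a proper closed subspace for every \<open>M\<close>, and for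
  every vector \<open>x\<close> a nonzero combination of two of them vanishes on the whole orbit of \<open>x\<close>.\<close>

section \<open>Operators whose range is not dense\<close>

lemma bounded_clinear_imp_bounded_linear:
  fixes f :: "'a::complex_normed_vector \<Rightarrow> 'b::complex_normed_vector"
  assumes "bounded_clinear f"
  shows "bounded_linear f"
proof -
  obtain K where "clinear f" "\<And>x. norm (f x) \<le> K * norm x"
    using assms by (auto simp: bounded_clinear_def)
  then show ?thesis
    by (intro bounded_linear_intro[where K = K])
      (simp_all add: clinear_add clinear_scaleC scaleR_scaleC mult.commute)
qed

lemma clinear_sum:
  assumes "clinear f"
  shows "f (sum g A) = (\<Sum>i\<in>A. f (g i))"
proof -
  have "f 0 = 0" using clinear_scaleC[OF assms, of 0 0] by simp
  then show ?thesis
    by (induction A rule: infinite_finite_induct) (auto simp: clinear_add[OF assms])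
qed

lemma closure_of_meets_open:
  assumes "x \<in> X closure_of S" "openin X U" "x \<in> U"
  obtains y where "y \<in> S" "y \<in> U"
  using assms by (auto simp: in_closure_of)

text \<open>The union over \<open>k\<close> starts at 1, so for every subspace it lies in the range
  of \<open>T\<close> and hence in the kernel of \<open>f\<close>. The set where \<open>f\<close> is
  nonzero is weakly open and contains \<open>u\<close>, so \<open>u\<close> is no weak limit point
  of the union.\<close>

lemma not_weakly_n_supercyclic_if_range_in_kernel:
  fixes T :: "'a::complex_normed_vector \<Rightarrow> 'a"
  assumes f: "bounded_clinear f" and fT: "\<And>x. f (T x) = (0::complex)" and u: "f u = 1"
  shows "\<not> weakly_n_supercyclic n T"
proof
  assume "weakly_n_supercyclic n T"
  then obtain B where "weak_topology closure_of (\<Union>k\<in>{1..}. (T ^^ k) ` cspan B) = UNIV"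
    by (auto simp: weakly_n_supercyclic_def)
  then have "u \<in> weak_topology closure_of (\<Union>k\<in>{1..}. (T ^^ k) ` cspan B)" by simp
  moreover have "openin weak_topology (f -` (- {0}))"
    unfolding weak_topology_def using f open_Compl[OF closed_singleton[of "0::complex"]]
    by (intro topology_generated_by_Basis) blast
  moreover have "u \<in> f -` (- {0})" using u by simp
  ultimately obtain z where "z \<in> (\<Union>k\<in>{1..}. (T ^^ k) ` cspan B)" "z \<in> f -` (- {0})"
    by (rule closure_of_meets_open)
  then obtain k v where k: "k \<ge> (1::nat)" and v: "f ((T ^^ k) v) \<noteq> 0" by auto
  from k obtain m where "k = Suc m" using not0_implies_Suc by force
  with v show False by (simp add: fT)
qed

text \<open>The candidate \<open>x\<close> is refuted by one surjection onto the
  \<open>N\<close>-tuples whose coordinate 0 vanishes on all multiples of the orbit. Points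
  \<open>(T ^^ n) x\<close> with \<open>n\<close> positive are killed by every functional, so only
  \<open>x\<close> itself needs care. Biorthogonal vectors give surjectivity.\<close>

lemma not_N_weakly_supercyclic_if_range_in_kernels:
  fixes T :: "'a::complex_normed_vector \<Rightarrow> 'a" and f :: "nat \<Rightarrow> 'a \<Rightarrow> complex"
  assumes f: "\<And>i. bounded_clinear (f i)" and fT: "\<And>i x. f i (T x) = 0"
    and u: "\<And>i j. f i (u j) = (if i = j then 1 else 0)" and N: "N \<ge> 1"
  shows "\<not> N_weakly_supercyclic N T"
proof
  assume "N_weakly_supercyclic N T"
  then obtain x where x: "\<And>\<gamma>. continuous_map euclidean (complex_space N) \<gamma> \<Longrightarrow>
      \<gamma> ` UNIV = topspace (complex_space N) \<Longrightarrow> (\<And>i. i < N \<Longrightarrow> clinear (\<lambda>z. \<gamma> z i)) \<Longrightarrow>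
      complex_space N closure_of (\<gamma> ` {c *\<^sub>C (T ^^ n) x | c n. True}) = topspace (complex_space N)"
    unfolding N_weakly_supercyclic_def by blast
  have "\<exists>g w. (\<forall>i. bounded_clinear (g i)) \<and> (\<forall>i x. g i (T x) = (0::complex)) \<and>
      (\<forall>i j. g i (w j) = (if i = j then 1 else 0)) \<and> g (0::nat) x = 0"
  proof (cases "f 0 x = 0")
    case True
    with f fT u show ?thesis by (intro exI[of _ f] exI[of _ u]) simp
  next
    case False
    \<comment> \<open>Subtracting the right multiple of \<open>f 0\<close> makes each
      \<open>g i\<close> vanish at \<open>x\<close>. Since \<open>f 0\<close> vanishes at every
      \<open>u (Suc j)\<close>, biorthogonality survives with indices raised by one.\<close>
    define g where "g i z = f (Suc i) z - f (Suc i) x / f 0 x * f 0 z" for i z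
    have "bounded_clinear (g i)" for i
      unfolding bounded_clinear_def
    proof
      have cl: "clinear (f j)" for j using f by (simp add: bounded_clinear_def)
      show "clinear (g i)"
        by (rule clinearI)
          (simp_all add: g_def clinear_add[OF cl] clinear_scaleC[OF cl] scaleC_complex_def algebra_simps add_divide_distrib)
      have "\<forall>j. \<exists>K. \<forall>z. norm (f j z) \<le> K * norm z"
        using f by (simp add: bounded_clinear_def)
      then obtain K where K: "\<And>j z. norm (f j z) \<le> K j * norm z"
        by metis
      have "norm (g i z) \<le> (K (Suc i) + norm (f (Suc i) x / f 0 x) * K 0) * norm z" for z
      proof -
        have "norm (g i z) \<le> norm (f (Suc i) z) + norm (f (Suc i) x / f 0 x) * norm (f 0 z)"
          unfolding g_def norm_mult[symmetric] by (rule norm_triangle_ineq4)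
        also have "\<dots> \<le> K (Suc i) * norm z + norm (f (Suc i) x / f 0 x) * (K 0 * norm z)"
          by (intro add_mono mult_left_mono K) simp
        finally show ?thesis by (simp add: algebra_simps)
      qed
      then show "\<exists>K. \<forall>z. norm (g i z) \<le> K * norm z" by blast
    qed
    moreover have "g i (T z) = 0" for i z by (simp add: g_def fT)
    moreover have "g i (u (Suc j)) = (if i = j then 1 else 0)" for i j by (simp add: g_def u)
    moreover have "g 0 x = 0" using False by (simp add: g_def)
    ultimately show ?thesis by (intro exI[of _ g] exI[of _ "\<lambda>j. u (Suc j)"]) simp
  qed
  then obtain g w where g: "\<And>i. bounded_clinear (g i)" and gT: "\<And>i x. g i (T x) = (0::complex)"
    and w: "\<And>i j. g i (w j) = (if i = j then 1 else 0)" and gx: "g (0::nat) x = 0"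
    by blast
  have cl: "clinear (g i)" for i using g by (simp add: bounded_clinear_def)
  \<comment> \<open>Points of \<open>complex_space N\<close> are \<open>undefined\<close> from index
    \<open>N\<close> on, which \<open>restrict\<close> provides.\<close>
  define \<gamma> where "\<gamma> z = restrict (\<lambda>i. g i z) {..<N}" for z
  have "continuous_map euclidean (complex_space N) \<gamma>"
    unfolding complex_space_def continuous_map_componentwise
  proof (intro conjI ballI)
    show "\<gamma> ` topspace euclidean \<subseteq> extensional {..<N}" by (auto simp: \<gamma>_def)
    fix i assume "i \<in> {..<N}"
    then show "continuous_map euclidean euclidean (\<lambda>z. \<gamma> z i)"
      using linear_continuous_on[OF bounded_clinear_imp_bounded_linear[OF g]]
      by (simp add: \<gamma>_def)
  qed
  moreover have "\<gamma> ` UNIV = topspace (complex_space N)"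
  proof (intro equalityI subsetI)
    fix p assume p: "p \<in> topspace (complex_space N)"
    define z where "z = (\<Sum>j<N. p j *\<^sub>C w j)"
    have "g i z = p i" if "i < N" for i
    proof -
      have "g i z = (\<Sum>j<N. if j = i then p j else 0)"
        unfolding z_def clinear_sum[OF cl]
        by (intro sum.cong) (auto simp: clinear_scaleC[OF cl] w scaleC_complex_def)
      with that show ?thesis by simp
    qed
    moreover have "p \<in> extensional {..<N}" using p by (simp add: complex_space_def PiE_def)
    ultimately have "\<gamma> z = p"
      unfolding \<gamma>_def by (intro extensionalityI[of _ "{..<N}"]) simp_all
    then show "p \<in> \<gamma> ` UNIV" by blast
  next
    fix p assume "p \<in> \<gamma> ` UNIV"
    then obtain z where "p = restrict (\<lambda>i. g i z) {..<N}" unfolding \<gamma>_def by blast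
    then show "p \<in> topspace (complex_space N)" by (simp add: complex_space_def)
  qed
  moreover have "clinear (\<lambda>z. \<gamma> z i)" if "i < N" for i
    using that cl[of i] by (simp add: \<gamma>_def)
  ultimately have dense: "complex_space N closure_of (\<gamma> ` {c *\<^sub>C (T ^^ n) x | c n. True}) =
      topspace (complex_space N)"
    by (rule x)
  \<comment> \<open>The image of \<open>w 0\<close> has coordinate 0 equal to 1. Having a nonzero
    coordinate 0 is an open condition that no point of the projected orbit satisfies.\<close>
  have "\<gamma> (w 0) \<in> topspace (complex_space N)" by (simp add: \<gamma>_def complex_space_def)
  then have "\<gamma> (w 0) \<in> complex_space N closure_of (\<gamma> ` {c *\<^sub>C (T ^^ n) x | c n. True})"
    by (simp only: dense)
  moreover have "openin (complex_space N) {p \<in> topspace (complex_space N). p 0 \<in> - {0}}"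
  proof (rule openin_continuous_map_preimage)
    show "continuous_map (complex_space N) euclidean (\<lambda>p. p 0)"
      unfolding complex_space_def using N
      by (intro continuous_map_product_projection) simp
  qed (simp add: open_Compl)
  moreover have "\<gamma> (w 0) \<in> {p \<in> topspace (complex_space N). p 0 \<in> - {0}}"
    using N by (simp add: \<gamma>_def complex_space_def w)
  ultimately obtain p where "p \<in> \<gamma> ` {c *\<^sub>C (T ^^ n) x | c n. True}"
    "p \<in> {p \<in> topspace (complex_space N). p 0 \<in> - {0}}"
    by (rule closure_of_meets_open)
  then obtain c n where "\<gamma> (c *\<^sub>C (T ^^ n) x) 0 \<noteq> 0" by auto
  moreover have "g 0 ((T ^^ n) x) = 0" by (cases n) (simp_all add: gT gx)
  ultimately show False using N by (simp add: \<gamma>_def clinear_scaleC[OF cl] scaleC_complex_def)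
qed

section \<open>Finite rank projections\<close>

lemma cinner_sum_right: "cinner (y::'a::chilbert_space) (sum f F) = (\<Sum>i\<in>F. cinner y (f i))"
  by (induction F rule: infinite_finite_induct) (auto simp: cinner_add_right)

text \<open>For a unit vector \<open>v\<close> this is the orthogonal projection onto the line
  through \<open>v\<close>.\<close>

definition rank_one :: "'h::chilbert_space \<Rightarrow> 'h \<Rightarrow>\<^sub>L 'h" where
  "rank_one v = Blinfun (\<lambda>h. cinner h v *\<^sub>C v)"

lemma rank_one_apply: "rank_one v h = cinner h v *\<^sub>C v"
proof -
  have "bounded_linear (\<lambda>h. cinner h v *\<^sub>C v)"
  proof (rule bounded_linear_intro[where K = "norm v * norm v"])
    fix h
    have "norm (cinner h v *\<^sub>C v) \<le> (norm h * norm v) * norm v"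
      unfolding norm_scaleC by (intro mult_right_mono cinner_Cauchy_Schwarz) simp
    then show "norm (cinner h v *\<^sub>C v) \<le> norm h * (norm v * norm v)" by (simp add: mult.assoc)
  qed (simp_all add: cinner_add_left scaleC_add_left scaleR_scaleC cinner_scaleC_left scaleC_scaleC)
  then show ?thesis by (simp add: rank_one_def bounded_linear_Blinfun_apply)
qed

text \<open>The unit ball is mapped into the multiples of \<open>v\<close> with coefficients in a
  closed disc, a compact set.\<close>

lemma rank_one_compact: "rank_one v \<in> compact_operators"
proof -
  have cl: "clinear (blinfun_apply (rank_one v))"
    by (rule clinearI)
      (simp_all add: rank_one_apply cinner_add_left scaleC_add_left cinner_scaleC_left scaleC_scaleC)
  have "bounded_linear (\<lambda>c. c *\<^sub>C v)"
    by (rule bounded_linear_intro[where K = "norm v"])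
      (simp_all add: scaleC_add_left scaleR_scaleC scaleC_scaleC norm_scaleC scaleC_complex_def)
  then have "compact ((\<lambda>c. c *\<^sub>C v) ` cball 0 (norm v))"
    by (intro compact_continuous_image linear_continuous_on) auto
  moreover have "blinfun_apply (rank_one v) ` cball 0 1 \<subseteq> (\<lambda>c. c *\<^sub>C v) ` cball 0 (norm v)"
  proof
    fix z assume "z \<in> blinfun_apply (rank_one v) ` cball 0 1"
    then obtain h where h: "norm h \<le> 1" "z = cinner h v *\<^sub>C v" by (auto simp: rank_one_apply)
    have "cmod (cinner h v) \<le> norm h * norm v" by (rule cinner_Cauchy_Schwarz)
    also have "\<dots> \<le> 1 * norm v" using h by (intro mult_right_mono) auto
    finally show "z \<in> (\<lambda>c. c *\<^sub>C v) ` cball 0 (norm v)" using h by auto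
  qed
  ultimately have "compact (closure (blinfun_apply (rank_one v) ` cball 0 1))"
    by (rule compact_closure_subset[rotated])
  with cl show ?thesis by (simp add: compact_operators_def)
qed

lemma compact_operators_compose:
  assumes "clinear (blinfun_apply A)" and B: "B \<in> compact_operators"
  shows "A o\<^sub>L B \<in> compact_operators"
proof -
  let ?C = "closure (blinfun_apply B ` cball 0 1)"
  have "compact (blinfun_apply A ` ?C)"
    using B by (intro compact_continuous_image linear_continuous_on blinfun.bounded_linear_right)
      (auto simp: compact_operators_def)
  moreover have "blinfun_apply (A o\<^sub>L B) ` cball 0 1 \<subseteq> blinfun_apply A ` ?C"
    using closure_subset[of "blinfun_apply B ` cball 0 1"] by auto
  ultimately have "compact (closure (blinfun_apply (A o\<^sub>L B) ` cball 0 1))"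
    by (rule compact_closure_subset[rotated])
  moreover have "clinear (blinfun_apply (A o\<^sub>L B))"
    by (rule clinearI) (simp_all add: assms compact_operators_clinear[OF B] clinear_add clinear_scaleC)
  ultimately show ?thesis by (simp add: compact_operators_def)
qed

text \<open>For orthonormal \<open>e\<close> and finite \<open>F\<close> this is the orthogonal
  projection onto the span of the \<open>e i\<close> with \<open>i\<close> in \<open>F\<close>. For
  infinite \<open>F\<close> the sum is 0 by convention, so compactness and self-adjointness hold for
  every \<open>F\<close>.\<close>

definition onb_proj :: "('i \<Rightarrow> 'h::chilbert_space) \<Rightarrow> 'i set \<Rightarrow> 'h \<Rightarrow>\<^sub>L 'h" where
  "onb_proj e F = (\<Sum>i\<in>F. rank_one (e i))"

lemma onb_proj_apply: "onb_proj e F h = (\<Sum>i\<in>F. cinner h (e i) *\<^sub>C e i)"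
  by (simp add: onb_proj_def blinfun.sum_left rank_one_apply)

lemma onb_proj_compact: "onb_proj e F \<in> compact_operators"
  unfolding onb_proj_def
  by (induction F rule: infinite_finite_induct)
    (auto simp: compact_operators_zero compact_operators_add rank_one_compact)

lemma adjoint_onb_proj: "adjoint_op (onb_proj e F) = onb_proj e F"
proof (rule adjoint_op_unique)
  show "clinear (blinfun_apply (onb_proj e F))"
    by (rule compact_operators_clinear[OF onb_proj_compact])
  show "cinner (onb_proj e F x) y = cinner x (onb_proj e F y)" for x y
    unfolding onb_proj_apply cinner_sum_left cinner_sum_right
    by (intro sum.cong)
      (simp_all add: cinner_scaleC_left cinner_scaleC_right cinner_commute[of "e _" y])
qed

context
  fixes e :: "'i \<Rightarrow> 'h::chilbert_space"
  assumes onb: "orthonormal_basis e"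
begin

lemma onb_cinner: "cinner (e i) (e j) = (if i = j then 1 else 0)"
  using onb by (simp add: orthonormal_basis_def)

lemma cinner_onb_proj:
  assumes "finite F" "i \<in> F"
  shows "cinner (onb_proj e F h) (e i) = cinner h (e i)"
proof -
  have "cinner (onb_proj e F h) (e i) = (\<Sum>j\<in>F. if j = i then cinner h (e i) else 0)"
    unfolding onb_proj_apply cinner_sum_left
    by (intro sum.cong) (auto simp: cinner_scaleC_left onb_cinner)
  with assms show ?thesis by simp
qed

text \<open>Pythagoras: \<open>h - onb_proj e F h\<close> is orthogonal to
  \<open>onb_proj e F h\<close>.\<close>

lemma norm_diff_onb_proj_le:
  assumes F: "finite F"
  shows "norm (h - onb_proj e F h) \<le> norm h"
proof -
  let ?P = "onb_proj e F h"
  have "cinner (h - ?P) ?P = (\<Sum>i\<in>F. cnj (cinner h (e i)) * cinner (h - ?P) (e i))"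
    by (subst (2) onb_proj_apply) (simp add: cinner_sum_right cinner_scaleC_right)
  also have "\<dots> = 0"
    by (rule sum.neutral) (simp add: cinner_diff_left cinner_onb_proj F)
  finally have "(norm h)\<^sup>2 = (norm (h - ?P))\<^sup>2 + (norm ?P)\<^sup>2"
    using norm_sq_add[of "h - ?P" ?P] by simp
  then have "(norm (h - ?P))\<^sup>2 \<le> (norm h)\<^sup>2" by simp
  then show ?thesis by (rule power2_le_imp_le) simp
qed

text \<open>Only finitely many basis vectors enter \<open>v\<close>. Allowing every finite superset
  of \<open>F0\<close> lets several vectors share one index set, both in the induction and in the
  covering argument that follows.\<close>

lemma onb_proj_eventually_fixes:
  assumes "v \<in> cspan (range e)"
  shows "\<exists>F0. finite F0 \<and> (\<forall>F. finite F \<and> F0 \<subseteq> F \<longrightarrow> onb_proj e F v = v)"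
  using assms
proof (induction rule: complex_vector.span_induct_alt)
  case base
  show ?case by (intro exI[of _ "{}"]) (simp add: blinfun.zero_right)
next
  case (step c x y)
  from step(1) obtain i where i: "x = e i" by blast
  from step(2) obtain F0 where F0: "finite F0"
    "\<And>F. finite F \<Longrightarrow> F0 \<subseteq> F \<Longrightarrow> onb_proj e F y = y" by blast
  have "onb_proj e F (e i) = e i" if F: "finite F" "i \<in> F" for F
  proof -
    have "onb_proj e F (e i) = (\<Sum>j\<in>F. if j = i then e i else 0)"
      unfolding onb_proj_apply by (intro sum.cong) (auto simp: onb_cinner scaleC_one)
    with F show ?thesis by simp
  qed
  then have "onb_proj e F (c *\<^sub>C x + y) = c *\<^sub>C x + y" if "finite F" "insert i F0 \<subseteq> F" for F
    using that F0(2)[of F] clinear_scaleC[OF compact_operators_clinear[OF onb_proj_compact[of e F]]]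
    by (simp add: blinfun.add_right i)
  with F0(1) show ?case by (intro exI[of _ "insert i F0"]) auto
qed

text \<open>Finitely many \<epsilon>-balls centred in the dense span cover \<open>K\<close>. One
  finite \<open>F\<close> fixes all the centres, and subtracting the projection does not increase
  norms.\<close>

lemma onb_proj_uniform:
  assumes K: "compact K" and \<epsilon>: "\<epsilon> > 0"
  shows "\<exists>F. finite F \<and> (\<forall>h\<in>K. norm (h - onb_proj e F h) \<le> \<epsilon>)"
proof -
  let ?D = "cspan (range e)"
  have cover: "K \<subseteq> (\<Union>v\<in>?D. ball v \<epsilon>)"
  proof
    fix h
    have "h \<in> closure ?D" using onb by (simp add: orthonormal_basis_def)
    then obtain v where "v \<in> ?D" "dist v h < \<epsilon>" using \<epsilon> by (auto simp: closure_approachable)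
    then show "h \<in> (\<Union>v\<in>?D. ball v \<epsilon>)" by auto
  qed
  obtain C where C: "C \<subseteq> ?D" "finite C" "K \<subseteq> (\<Union>v\<in>C. ball v \<epsilon>)"
    by (rule compactE_image[OF K _ cover]) auto
  have "\<forall>v\<in>?D. \<exists>F0. finite F0 \<and> (\<forall>F. finite F \<and> F0 \<subseteq> F \<longrightarrow> onb_proj e F v = v)"
    by (intro ballI onb_proj_eventually_fixes)
  from bchoice[OF this] obtain G where G: "\<And>v. v \<in> ?D \<Longrightarrow> finite (G v)"
    "\<And>v F. v \<in> ?D \<Longrightarrow> finite F \<Longrightarrow> G v \<subseteq> F \<Longrightarrow> onb_proj e F v = v" by auto
  define F where "F = (\<Union>v\<in>C. G v)"
  have F: "finite F" using C G(1) by (auto simp: F_def)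
  show ?thesis
  proof (intro exI conjI ballI)
    fix h assume "h \<in> K"
    with C(3) obtain v where v: "v \<in> C" "norm (v - h) < \<epsilon>" by (auto simp: dist_norm)
    have "onb_proj e F v = v"
      using v(1) C(1) F by (intro G(2)) (auto simp: F_def)
    \<comment> \<open>The centre \<open>v\<close> is fixed, so it contributes nothing and only the
      short vector \<open>h - v\<close> is left to estimate.\<close>
    then have "h - onb_proj e F h = (h - v) - onb_proj e F (h - v)"
      by (simp add: blinfun.diff_right)
    then have "norm (h - onb_proj e F h) \<le> norm (h - v)"
      using norm_diff_onb_proj_le[OF F] by metis
    with v(2) show "norm (h - onb_proj e F h) \<le> \<epsilon>" by (simp add: norm_minus_commute)
  qed (rule F)
qed

text \<open>The uniform estimate is applied to the compact closure of the image of the unit ball.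
  Projections onto finitely many basis vectors thus act as a left approximate identity on compact
  operators.\<close>

lemma onb_proj_compact_approx:
  assumes A: "A \<in> compact_operators" and \<epsilon>: "\<epsilon> > 0"
  shows "\<exists>F. norm (A - (onb_proj e F o\<^sub>L A)) \<le> \<epsilon>"
proof -
  have "compact (closure (blinfun_apply A ` cball 0 1))" using A by (simp add: compact_operators_def)
  from onb_proj_uniform[OF this \<epsilon>] obtain F where F: "finite F"
    and *: "\<forall>h\<in>closure (blinfun_apply A ` cball 0 1). norm (h - onb_proj e F h) \<le> \<epsilon>"
    by (elim exE conjE)
  have "norm (A - (onb_proj e F o\<^sub>L A)) \<le> \<epsilon>"
  proof (rule norm_blinfun_bound)
    let ?B = "A - (onb_proj e F o\<^sub>L A)"
    fix h
    show "norm (?B h) \<le> \<epsilon> * norm h"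
    proof (cases "h = 0")
      case False
      let ?u = "(1 / norm h) *\<^sub>R h"
      have "A ?u \<in> closure (blinfun_apply A ` cball 0 1)"
        using False by (intro subsetD[OF closure_subset]) auto
      from bspec[OF * this] have "norm (?B ?u) \<le> \<epsilon>" by (simp add: minus_blinfun.rep_eq)
      also have "?B ?u = (1 / norm h) *\<^sub>R ?B h" by (rule blinfun.scaleR_right)
      finally show ?thesis using False by (simp add: divide_le_eq)
    qed (simp add: blinfun.zero_right)
  qed (use \<epsilon> in simp)
  then show ?thesis ..
qed

end

section \<open>The shift on the standard Hilbert module\<close>

text \<open>Stated over any complex vector space, so that one formula serves sequences of operators
  and sequences of numbers.\<close>

definition gapped_shift :: "(nat \<Rightarrow> 'a::complex_vector) \<Rightarrow> nat \<Rightarrow> 'a" where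
  "gapped_shift x j = (if even j then 2 *\<^sub>C x (j + 2) else 0)"

text \<open>An even coordinate only ever reads even coordinates, so the weights multiply to
  \<open>2 ^ n\<close>. Odd coordinates become 0 at the first application, hence the separate case
  \<open>n = 0\<close>.\<close>

lemma gapped_shift_funpow:
  "(gapped_shift ^^ n) x j = (if even j then 2 ^ n *\<^sub>C x (j + 2 * n) else if n = 0 then x j else 0)"
  by (induction n arbitrary: j)
    (auto simp: gapped_shift_def scaleC_one scaleC_scaleC algebra_simps)

lemma scaleC_two_power: "2 ^ n *\<^sub>C x = (2 ^ n :: real) *\<^sub>R (x :: 'a::complex_vector)"
  by (simp add: scaleR_scaleC)

section \<open>Boundedness of the shift on the module\<close>

text \<open>Gram sums are positive operators whose quadratic forms are the square sums in
  \<open>le\<close>, so domination of the forms gives domination of the norms. Different index sets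
  \<open>F\<close> and \<open>G\<close> allow a comparison of shifted ranges.\<close>

lemma gram_sum_dominated:
  fixes x y :: "nat \<Rightarrow> 'h::chilbert_space \<Rightarrow>\<^sub>L 'h"
  assumes x: "\<And>j. clinear (blinfun_apply (x j))" and y: "\<And>j. clinear (blinfun_apply (y j))"
    and c: "c \<ge> 0" and le: "\<And>h. (\<Sum>j\<in>F. (norm (y j h))\<^sup>2) \<le> c * (\<Sum>j\<in>G. (norm (x j h))\<^sup>2)"
  shows "norm (\<Sum>j\<in>F. adjoint_op (y j) o\<^sub>L y j) \<le> c * norm (\<Sum>j\<in>G. adjoint_op (x j) o\<^sub>L x j)"
    (is "norm ?S \<le> c * norm ?X")
proof (rule norm_blinfun_bound)
  have L: "L2_set (\<lambda>j. norm (y j h)) F \<le> sqrt (c * norm ?X) * norm h" for h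
  proof -
    have "L2_set (\<lambda>j. norm (y j h)) F \<le> sqrt c * L2_set (\<lambda>j. norm (x j h)) G"
      unfolding L2_set_def real_sqrt_mult[symmetric] by (intro real_sqrt_le_mono le)
    also have "\<dots> \<le> sqrt c * (sqrt (norm ?X) * norm h)"
      by (intro mult_left_mono gram_sum_self x) (use c in simp)
    finally show ?thesis by (simp add: real_sqrt_mult)
  qed
  fix h
  \<comment> \<open>Testing \<open>?S h\<close> against itself expresses its squared norm through
    inner products, to which Cauchy-Schwarz applies twice.\<close>
  define v where "v = ?S h"
  have "(norm v)\<^sup>2 = cmod (cinner (?S h) v)" by (simp add: cinner_self norm_power v_def)
  also have "\<dots> = cmod (\<Sum>j\<in>F. cinner (y j h) (y j v))"
    by (simp add: blinfun.sum_left cinner_sum_left cinner_adjoint_op_left y)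
  also have "\<dots> \<le> (\<Sum>j\<in>F. \<bar>norm (y j h)\<bar> * \<bar>norm (y j v)\<bar>)"
    by (intro sum_norm_le) (simp add: cinner_Cauchy_Schwarz)
  also have "\<dots> \<le> L2_set (\<lambda>j. norm (y j h)) F * L2_set (\<lambda>j. norm (y j v)) F"
    by (rule L2_set_mult_ineq)
  also have "\<dots> \<le> (sqrt (c * norm ?X) * norm h) * (sqrt (c * norm ?X) * norm v)"
    using c by (intro mult_mono L) auto
  also have "\<dots> = (sqrt (c * norm ?X) * sqrt (c * norm ?X)) * norm h * norm v"
    by (simp only: mult_ac)
  also have "sqrt (c * norm ?X) * sqrt (c * norm ?X) = c * norm ?X" using c by simp
  finally have "norm v * norm v \<le> (c * norm ?X * norm h) * norm v"
    by (simp add: power2_eq_square)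
  then have "norm v \<le> c * norm ?X * norm h"
    using c by (cases "v = 0") (auto simp: mult_le_cancel_right)
  then show "norm (?S h) \<le> c * norm ?X * norm h" by (simp add: v_def)
qed (use c in simp)

lemma clinear_blinfun_zero: "clinear (blinfun_apply (0 :: 'h::chilbert_space \<Rightarrow>\<^sub>L 'h))"
  by (rule compact_operators_clinear[OF compact_operators_zero])

lemma clinear_gapped_shift:
  fixes x :: "nat \<Rightarrow> 'h::chilbert_space \<Rightarrow>\<^sub>L 'h"
  assumes "\<And>j. clinear (blinfun_apply (x j))"
  shows "clinear (blinfun_apply (gapped_shift x j))"
  by (simp add: gapped_shift_def clinear_blinfun_zero clinear_blinfun_scaleC assms)

text \<open>Coordinate \<open>j\<close> reads \<open>j + 2\<close> with weight at most 2, whence the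
  moved range and the factor 4. Arbitrary blocks are treated because the Cauchy criterion for
  membership in the module needs them.\<close>

lemma gram_sum_gapped_shift:
  fixes x :: "nat \<Rightarrow> 'h::chilbert_space \<Rightarrow>\<^sub>L 'h"
  assumes x: "\<And>j. clinear (blinfun_apply (x j))"
  shows "norm (\<Sum>j=m..<n. adjoint_op (gapped_shift x j) o\<^sub>L gapped_shift x j) \<le>
    4 * norm (\<Sum>j=m+2..<n+2. adjoint_op (x j) o\<^sub>L x j)"
proof (rule gram_sum_dominated)
  fix h
  have "(\<Sum>j=m..<n. (norm (gapped_shift x j h))\<^sup>2) \<le> (\<Sum>j=m..<n. 4 * (norm (x (j + 2) h))\<^sup>2)"
    by (intro sum_mono) (simp add: gapped_shift_def scaleC_blinfun.rep_eq norm_scaleC power_mult_distrib)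
  also have "\<dots> = 4 * (\<Sum>j=m+2..<n+2. (norm (x j h))\<^sup>2)"
    by (simp only: sum_distrib_left sum.shift_bounds_nat_ivl)
  finally show "(\<Sum>j=m..<n. (norm (gapped_shift x j h))\<^sup>2) \<le> 4 * (\<Sum>j=m+2..<n+2. (norm (x j h))\<^sup>2)" .
qed (simp_all add: x clinear_gapped_shift)

lift_definition std_shift :: "'h::chilbert_space std_module \<Rightarrow> 'h std_module" is gapped_shift
proof (intro conjI allI; elim conjE)
  fix x :: "nat \<Rightarrow> 'h \<Rightarrow>\<^sub>L 'h"
  assume x: "\<forall>j. x j \<in> compact_operators" and s: "summable (\<lambda>j. adjoint_op (x j) o\<^sub>L x j)"
  show "gapped_shift x j \<in> compact_operators" for j
    using x by (simp add: gapped_shift_def compact_operators_zero compact_operators_scaleC)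
  have cl: "clinear (blinfun_apply (x j))" for j using x by (simp add: compact_operators_clinear)
  show "summable (\<lambda>j. adjoint_op (gapped_shift x j) o\<^sub>L gapped_shift x j)"
    unfolding summable_Cauchy
  proof (intro allI impI)
    fix \<epsilon> :: real assume "\<epsilon> > 0"
    then have "\<epsilon> / 4 > 0" by simp
    with s obtain N where N: "\<And>m n. m \<ge> N \<Longrightarrow> norm (\<Sum>j=m..<n. adjoint_op (x j) o\<^sub>L x j) < \<epsilon> / 4"
      unfolding summable_Cauchy by blast
    have "norm (\<Sum>j=m..<n. adjoint_op (gapped_shift x j) o\<^sub>L gapped_shift x j) < \<epsilon>" if "m \<ge> N" for m n
      using gram_sum_gapped_shift[of x m n, OF cl] N[of "m + 2" "n + 2"] that by linarith
    then show "\<exists>N. \<forall>m\<ge>N. \<forall>n. norm (\<Sum>j=m..<n. adjoint_op (gapped_shift x j) o\<^sub>L gapped_shift x j) < \<epsilon>"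
      by blast
  qed
qed

lemma mod_nth_std_shift_funpow: "mod_nth ((std_shift ^^ n) x) = (gapped_shift ^^ n) (mod_nth x)"
  by (induction n) (simp_all add: std_shift.rep_eq)

lemma mod_inner_self_LIMSEQ:
  "(\<lambda>n. \<Sum>j<n. adjoint_op (mod_nth x j) o\<^sub>L mod_nth x j) \<longlonglongrightarrow> mod_inner x x"
  unfolding mod_inner_def by (rule summable_LIMSEQ[OF mod_inner_summable])

lemma norm_std_shift_le: "norm (std_shift x) \<le> 2 * norm x"
proof -
  let ?G = "\<lambda>x n. \<Sum>j<n. adjoint_op (mod_nth x j) o\<^sub>L mod_nth x j"
  have "norm (mod_inner (std_shift x) (std_shift x)) \<le> 4 * norm (mod_inner x x)"
  proof (rule LIMSEQ_le)
    show "(\<lambda>n. norm (?G (std_shift x) n)) \<longlonglongrightarrow> norm (mod_inner (std_shift x) (std_shift x))"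
      by (intro tendsto_norm mod_inner_self_LIMSEQ)
    show "(\<lambda>n. 4 * norm (?G x (n + 2))) \<longlonglongrightarrow> 4 * norm (mod_inner x x)"
      by (intro tendsto_mult tendsto_const tendsto_norm LIMSEQ_ignore_initial_segment mod_inner_self_LIMSEQ)
    have "norm (?G (std_shift x) n) \<le> 4 * norm (?G x (n + 2))" for n
    proof (rule gram_sum_dominated)
      fix h
      have "(\<Sum>j<n. (norm (mod_nth (std_shift x) j h))\<^sup>2) \<le> (\<Sum>j<n. 4 * (norm (mod_nth x (j + 2) h))\<^sup>2)"
        by (intro sum_mono) (simp add: std_shift.rep_eq gapped_shift_def scaleC_blinfun.rep_eq
            norm_scaleC power_mult_distrib)
      also have "\<dots> = 4 * (\<Sum>j=0+2..<n+2. (norm (mod_nth x j h))\<^sup>2)"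
        by (simp only: sum_distrib_left sum.shift_bounds_nat_ivl lessThan_atLeast0)
      also have "\<dots> \<le> 4 * (\<Sum>j<n+2. (norm (mod_nth x j h))\<^sup>2)"
        by (intro mult_left_mono sum_mono2) auto
      finally show "(\<Sum>j<n. (norm (mod_nth (std_shift x) j h))\<^sup>2) \<le> 4 * (\<Sum>j<n+2. (norm (mod_nth x j h))\<^sup>2)" .
    qed (simp_all add: mod_nth_clinear)
    then show "\<exists>N. \<forall>n\<ge>N. norm (?G (std_shift x) n) \<le> 4 * norm (?G x (n + 2))" by blast
  qed
  then have "sqrt (norm (mod_inner (std_shift x) (std_shift x))) \<le> sqrt (4 * norm (mod_inner x x))"
    by (rule real_sqrt_le_mono)
  then show ?thesis by (simp add: norm_std_module_def real_sqrt_mult)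
qed

lemma bounded_clinear_std_shift:
  "bounded_clinear (std_shift :: 'h::chilbert_space std_module \<Rightarrow> 'h std_module)"
  unfolding bounded_clinear_def
proof
  show "clinear (std_shift :: 'h std_module \<Rightarrow> _)"
  proof (rule clinearI)
    show "std_shift (x + y) = std_shift x + std_shift y" for x y :: "'h std_module"
      by transfer (simp add: gapped_shift_def fun_eq_iff scaleC_add_right)
    show "std_shift (c *\<^sub>C x) = c *\<^sub>C std_shift x" for c and x :: "'h std_module"
      by transfer (simp add: gapped_shift_def fun_eq_iff scaleC_scaleC mult.commute)
  qed
qed (use norm_std_shift_le in blast)

section \<open>Finitely supported elements of the module\<close>

lemma mod_nth_scaleR: "mod_nth (r *\<^sub>R x) j = r *\<^sub>R mod_nth x j"
  by (simp add: scaleR_scaleC scaleC_std_module.rep_eq)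

lemma mod_nth_diff: "mod_nth (x - y) j = mod_nth x j - mod_nth y j"
proof -
  have "mod_nth x j = mod_nth ((x - y) + y) j" by simp
  then show ?thesis unfolding plus_std_module.rep_eq by (simp add: algebra_simps)
qed

lemma finite_support_gram_summable:
  fixes x :: "nat \<Rightarrow> 'h::chilbert_space \<Rightarrow>\<^sub>L 'h"
  assumes "finite {j. x j \<noteq> 0}"
  shows "summable (\<lambda>j. adjoint_op (x j) o\<^sub>L x j)"
  using assms by (rule summable_finite) simp

text \<open>The test inside makes the function total: an operator that is not compact yields the
  zero element.\<close>

lift_definition std_single :: "nat \<Rightarrow> ('h::chilbert_space \<Rightarrow>\<^sub>L 'h) \<Rightarrow> 'h std_module"
  is "\<lambda>k A j. if j = k \<and> A \<in> compact_operators then A else 0"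
  by (auto simp: compact_operators_zero intro!: finite_support_gram_summable
      intro: finite_subset[of _ "{k}" for k])

lift_definition std_truncate :: "nat \<Rightarrow> 'h::chilbert_space std_module \<Rightarrow> 'h std_module"
  is "\<lambda>n x j. if j < n then x j else 0"
  by (auto simp: compact_operators_zero intro!: finite_support_gram_summable
      intro: finite_subset[of _ "{..<n}" for n])

lemma mod_nth_std_single:
  "A \<in> compact_operators \<Longrightarrow> mod_nth (std_single k A) j = (if j = k then A else 0)"
  by (simp add: std_single.rep_eq)

lemma mod_inner_single_support:
  assumes "\<And>j. j \<noteq> k \<Longrightarrow> mod_nth x j = 0"
  shows "mod_inner x y = adjoint_op (mod_nth y k) o\<^sub>L mod_nth x k"
proof -
  have "mod_inner x y = (\<Sum>j\<in>{k}. adjoint_op (mod_nth y j) o\<^sub>L mod_nth x j)"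
    unfolding mod_inner_def by (rule suminf_finite) (auto simp: assms)
  then show ?thesis by simp
qed

lemma norm_std_single:
  "A \<in> compact_operators \<Longrightarrow> norm (std_single k A) = sqrt (norm (adjoint_op A o\<^sub>L A))"
  by (simp add: norm_std_module_def mod_inner_single_support[of k] mod_nth_std_single)

text \<open>The tail left by truncation has as Gram operator exactly \<open>mod_inner x x\<close>
  minus a partial sum. So finitely supported elements, which high powers of the shift annihilate,
  are dense.\<close>

lemma std_truncate_LIMSEQ: "(\<lambda>n. std_truncate n x) \<longlonglongrightarrow> x"
proof -
  let ?g = "\<lambda>j. adjoint_op (mod_nth x j) o\<^sub>L mod_nth x j"
  have d: "mod_inner (x - std_truncate n x) (x - std_truncate n x) = mod_inner x x - (\<Sum>j<n. ?g j)" for n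
  proof -
    have "?g sums mod_inner x x" unfolding mod_inner_def by (rule summable_sums[OF mod_inner_summable])
    from sums_diff[OF this sums_If_finite_set[of "{..<n}" ?g]]
    have "(\<lambda>j. ?g j - (if j < n then ?g j else 0)) sums (mod_inner x x - (\<Sum>j<n. ?g j))" by simp
    moreover have "?g j - (if j < n then ?g j else 0) =
      adjoint_op (mod_nth (x - std_truncate n x) j) o\<^sub>L mod_nth (x - std_truncate n x) j" for j
      by (simp add: mod_nth_diff std_truncate.rep_eq)
    ultimately show ?thesis unfolding mod_inner_def[of "x - std_truncate n x"] by (simp add: sums_iff)
  qed
  have "(\<lambda>n. mod_inner x x - (\<Sum>j<n. ?g j)) \<longlonglongrightarrow> mod_inner x x - mod_inner x x"
    by (intro tendsto_diff tendsto_const mod_inner_self_LIMSEQ)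
  then have "(\<lambda>n. sqrt (norm (mod_inner x x - (\<Sum>j<n. ?g j)))) \<longlonglongrightarrow> sqrt (norm (mod_inner x x - mod_inner x x))"
    by (intro tendsto_real_sqrt tendsto_norm)
  then have "(\<lambda>n. norm (x - std_truncate n x)) \<longlonglongrightarrow> 0"
    by (simp add: norm_std_module_def d)
  then have "(\<lambda>n. dist (std_truncate n x) x) \<longlonglongrightarrow> 0"
    by (simp only: dist_norm norm_minus_commute[of _ x])
  then show ?thesis by (rule tendsto_dist_iff[THEN iffD2])
qed

text \<open>One term is at most the whole square sum, which \<open>gram_sum_self\<close> controls.
  This bounds the coordinate functionals used against supercyclicity.\<close>

lemma norm_mod_nth_apply_le: "norm (mod_nth x j h) \<le> norm x * norm h"
proof (rule LIMSEQ_le_const)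
  let ?G = "\<lambda>n. \<Sum>j<n. adjoint_op (mod_nth x j) o\<^sub>L mod_nth x j"
  show "(\<lambda>n. sqrt (norm (?G n)) * norm h) \<longlonglongrightarrow> norm x * norm h"
    unfolding norm_std_module_def
    by (intro tendsto_mult tendsto_const tendsto_real_sqrt tendsto_norm mod_inner_self_LIMSEQ)
  have "norm (mod_nth x j h) \<le> sqrt (norm (?G n)) * norm h" if "n \<ge> Suc j" for n
  proof -
    have "norm (mod_nth x j h) \<le> L2_set (\<lambda>j. norm (mod_nth x j h)) {..<n}"
      using that by (intro member_le_L2_set) auto
    also have "\<dots> \<le> sqrt (norm (?G n)) * norm h" by (rule gram_sum_self[OF mod_nth_clinear])
    finally show ?thesis .
  qed
  then show "\<exists>N. \<forall>n\<ge>N. norm (mod_nth x j h) \<le> sqrt (norm (?G n)) * norm h" by blast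
qed

section \<open>Transitivity of the shift on the module\<close>

lemma adjoint_op_scaleR:
  "clinear (blinfun_apply A) \<Longrightarrow> adjoint_op (r *\<^sub>R A) = r *\<^sub>R adjoint_op A"
  by (simp add: scaleR_scaleC adjoint_op_scaleC)

lemma Cstar_transitive_std_shift:
  fixes e :: "'i \<Rightarrow> 'h::chilbert_space"
  assumes onb: "orthonormal_basis e"
  shows "Cstar_transitive (std_shift :: 'h std_module \<Rightarrow> 'h std_module)"
  unfolding Cstar_transitive_def
proof (intro allI impI, elim conjE)
  fix W :: "('h std_module \<times> 'h std_module) set" and V :: "('h \<Rightarrow>\<^sub>L 'h) set"
  assume "openin (top_of_set (sphere 0 1 \<times> sphere 0 1)) W" and "W \<noteq> {}"
    and "openin (top_of_set compact_operators) V" and "V \<noteq> {}"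
  then obtain W' V' where W': "open W'" "W = (sphere 0 1 \<times> sphere 0 1) \<inter> W'"
    and V': "open V'" "V = compact_operators \<inter> V'"
    by (auto simp: openin_open)
  from \<open>W \<noteq> {}\<close> obtain x0 y0 where xy0: "(x0, y0) \<in> W" by auto
  from \<open>V \<noteq> {}\<close> obtain C where C: "C \<in> V" by auto
  have Cc: "C \<in> compact_operators" and "C \<in> V'" using C V'(2) by auto
  with V'(1) obtain \<epsilon> where \<epsilon>: "\<epsilon> > 0" "\<And>B. dist B C < \<epsilon> \<Longrightarrow> B \<in> V'"
    unfolding open_dist by metis
  obtain F where F: "norm (C - (onb_proj e F o\<^sub>L C)) \<le> \<epsilon> / 2"
    using onb_proj_compact_approx[OF onb Cc, of "\<epsilon> / 2"] \<epsilon>(1) by auto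
  \<comment> \<open>The target \<open>C\<close> is replaced by \<open>P o\<^sub>L C\<close>, still
    inside the open set. This product can be attained exactly in the limit, since \<open>P\<close>
    is its own adjoint and can be planted in a coordinate of the second vector.\<close>
  define P where "P = onb_proj e F"
  have P: "P \<in> compact_operators" "adjoint_op P = P"
    by (simp_all add: P_def onb_proj_compact adjoint_onb_proj)
  have "dist (P o\<^sub>L C) C \<le> \<epsilon> / 2"
    using F by (simp only: P_def dist_norm norm_minus_commute[of _ C])
  with \<epsilon> have PC: "P o\<^sub>L C \<in> V'" by auto
  have PCc: "P o\<^sub>L C \<in> compact_operators"
    by (rule compact_operators_compose[OF compact_operators_clinear[OF P(1)] Cc])

  \<comment> \<open>\<open>sgn\<close> returns the truncations to the unit sphere and is continuous
    at \<open>x0\<close> and \<open>y0\<close>, which it fixes. An even length is chosen because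
    only even coordinates receive entries from the shift.\<close>
  obtain k where k: "even k" "sgn (std_truncate k x0) \<noteq> 0" "sgn (std_truncate k y0) \<noteq> 0"
      "(sgn (std_truncate k x0), sgn (std_truncate k y0)) \<in> W'"
  proof -
    have n0: "norm x0 = 1" "norm y0 = 1" using xy0 W'(2) by auto
    then have "x0 \<noteq> 0" "y0 \<noteq> 0" by auto
    have "sgn x0 = x0" "sgn y0 = y0" using n0 by (simp_all add: sgn_div_norm)
    have tx: "(\<lambda>n. sgn (std_truncate n x0)) \<longlonglongrightarrow> x0" and ty: "(\<lambda>n. sgn (std_truncate n y0)) \<longlonglongrightarrow> y0"
      using tendsto_sgn[OF std_truncate_LIMSEQ \<open>x0 \<noteq> 0\<close>] tendsto_sgn[OF std_truncate_LIMSEQ \<open>y0 \<noteq> 0\<close>]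
        \<open>sgn x0 = x0\<close> \<open>sgn y0 = y0\<close> by simp_all
    have "\<forall>\<^sub>F n in sequentially. sgn (std_truncate n x0) \<noteq> 0 \<and> sgn (std_truncate n y0) \<noteq> 0 \<and>
        (sgn (std_truncate n x0), sgn (std_truncate n y0)) \<in> W'"
      using tendsto_imp_eventually_ne[OF tx \<open>x0 \<noteq> 0\<close>] tendsto_imp_eventually_ne[OF ty \<open>y0 \<noteq> 0\<close>]
        topological_tendstoD[OF tendsto_Pair[OF tx ty] W'(1)] xy0 W'(2)
      by (simp add: eventually_conj)
    then obtain N where "\<And>n. n \<ge> N \<Longrightarrow> sgn (std_truncate n x0) \<noteq> 0 \<and> sgn (std_truncate n y0) \<noteq> 0 \<and>
        (sgn (std_truncate n x0), sgn (std_truncate n y0)) \<in> W'"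
      unfolding eventually_sequentially by blast
    from this[of "2 * N"] show ?thesis by (intro that[of "2 * N"]) auto
  qed
  define x where "x = std_truncate k x0"
  define y where "y = std_truncate k y0"
  have xk: "mod_nth x j = 0" and yk: "mod_nth y j = 0" if "j \<ge> k" for j
    using that by (simp_all add: x_def y_def std_truncate.rep_eq)
  have x_ne: "x \<noteq> 0" and y_ne: "y \<noteq> 0" and xyW: "(sgn x, sgn y) \<in> W'"
    using k by (auto simp: x_def y_def)

  \<comment> \<open>Coordinate \<open>k\<close> of \<open>y\<close> is still empty, so a small
    multiple of \<open>P\<close> can be placed there without leaving the open set.\<close>
  obtain \<delta> where \<delta>: "\<delta> > 0" "y + \<delta> *\<^sub>R std_single k P \<noteq> 0" "(sgn x, sgn (y + \<delta> *\<^sub>R std_single k P)) \<in> W'"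
  proof -
    let ?y = "\<lambda>n. y + inverse (real (Suc n)) *\<^sub>R std_single k P"
    have "?y \<longlonglongrightarrow> y + 0 *\<^sub>R std_single k P"
      by (intro tendsto_add tendsto_scaleR tendsto_const LIMSEQ_inverse_real_of_nat)
    then have ty: "?y \<longlonglongrightarrow> y" by simp
    have "\<forall>\<^sub>F n in sequentially. ?y n \<noteq> 0 \<and> (sgn x, sgn (?y n)) \<in> W'"
      using tendsto_imp_eventually_ne[OF ty y_ne] xyW
        topological_tendstoD[OF tendsto_Pair[OF tendsto_const tendsto_sgn[OF ty y_ne]] W'(1)]
      by (simp add: eventually_conj)
    then obtain n where "?y n \<noteq> 0 \<and> (sgn x, sgn (?y n)) \<in> W'"
      using eventually_happens'[OF sequentially_bot] by blast
    then show ?thesis by (intro that[of "inverse (real (Suc n))"]) auto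
  qed
  define z where "z = y + \<delta> *\<^sub>R std_single k P"
  have zk: "mod_nth z k = \<delta> *\<^sub>R P"
    by (simp add: z_def plus_std_module.rep_eq mod_nth_scaleR yk mod_nth_std_single P(1))
  have z_ne: "z \<noteq> 0" and xzW: "(sgn x, sgn z) \<in> W'" using \<delta> by (simp_all add: z_def)

  \<comment> \<open>The factor \<open>(1 / 2) ^ n\<close> cancels the growth \<open>2 ^ n\<close> of
    the shift, and the constant cancels \<delta> and \<open>norm z\<close>. The pairing becomes
    \<open>norm x / norm (X n)\<close> times \<open>P o\<^sub>L C\<close>, with a scalar tending to
    1.\<close>
  define r where "r n = norm x * norm z / \<delta> * (1 / 2) ^ n" for n
  define X where "X n = x + r n *\<^sub>R std_single (2 * n + k) C" for n
  have "r \<longlonglongrightarrow> 0"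
    unfolding r_def by (intro tendsto_mult_right_zero LIMSEQ_realpow_zero) auto
  have "X \<longlonglongrightarrow> x"
  proof (rule tendsto_dist_iff[THEN iffD2])
    have "(\<lambda>n. \<bar>r n\<bar> * sqrt (norm (adjoint_op C o\<^sub>L C))) \<longlonglongrightarrow> 0"
      by (intro tendsto_mult_left_zero tendsto_rabs_zero \<open>r \<longlonglongrightarrow> 0\<close>)
    then show "(\<lambda>n. dist (X n) x) \<longlonglongrightarrow> 0"
      by (simp add: X_def dist_norm norm_std_single Cc)
  qed
  have "(\<lambda>n. (norm x / norm (X n)) *\<^sub>R (P o\<^sub>L C)) \<longlonglongrightarrow> (norm x / norm x) *\<^sub>R (P o\<^sub>L C)"
    by (intro tendsto_scaleR tendsto_divide tendsto_const tendsto_norm \<open>X \<longlonglongrightarrow> x\<close>) (simp add: x_ne)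
  then have lim: "(\<lambda>n. (norm x / norm (X n)) *\<^sub>R (P o\<^sub>L C)) \<longlonglongrightarrow> (P o\<^sub>L C)" using x_ne by simp
  have "\<forall>\<^sub>F n in sequentially. X n \<noteq> 0 \<and> (sgn (X n), sgn z) \<in> W' \<and>
      (norm x / norm (X n)) *\<^sub>R (P o\<^sub>L C) \<in> V' \<and> n \<ge> Suc k"
    using tendsto_imp_eventually_ne[OF \<open>X \<longlonglongrightarrow> x\<close> x_ne] topological_tendstoD[OF lim V'(1) PC]
      topological_tendstoD[OF tendsto_Pair[OF tendsto_sgn[OF \<open>X \<longlonglongrightarrow> x\<close> x_ne] tendsto_const] W'(1) xzW]
      eventually_ge_at_top[of "Suc k"]
    by (simp add: eventually_conj)
  then obtain n where n: "X n \<noteq> 0" "(sgn (X n), sgn z) \<in> W'"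
      "(norm x / norm (X n)) *\<^sub>R (P o\<^sub>L C) \<in> V'" "n \<ge> Suc k"
    using eventually_happens'[OF sequentially_bot] by blast
  \<comment> \<open>As \<open>n\<close> exceeds \<open>k\<close>, every coordinate
    \<open>j + 2 * n\<close> lies beyond the support of \<open>x\<close>. Only the entry planted at
    \<open>2 * n + k\<close> survives, and it lands at \<open>k\<close>.\<close>
  have "mod_nth ((std_shift ^^ n) (sgn (X n))) j =
      (if j = k then (2 ^ n * r n / norm (X n)) *\<^sub>R C else 0)" for j
    using n(4) k(1)
    by (auto simp: mod_nth_std_shift_funpow gapped_shift_funpow scaleC_two_power sgn_div_norm
        mod_nth_scaleR X_def plus_std_module.rep_eq xk mod_nth_std_single Cc divide_inverse mult_ac)
  then have "mod_inner ((std_shift ^^ n) (sgn (X n))) (sgn z) =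
      adjoint_op (mod_nth (sgn z) k) o\<^sub>L ((2 ^ n * r n / norm (X n)) *\<^sub>R C)"
    using mod_inner_single_support[of k "(std_shift ^^ n) (sgn (X n))"] by simp
  also have "mod_nth (sgn z) k = (\<delta> / norm z) *\<^sub>R P"
    by (simp add: sgn_div_norm mod_nth_scaleR zk divide_inverse mult.commute)
  also have "adjoint_op ((\<delta> / norm z) *\<^sub>R P) = (\<delta> / norm z) *\<^sub>R P"
    by (simp add: adjoint_op_scaleR compact_operators_clinear[OF P(1)] P(2))
  also have "((\<delta> / norm z) *\<^sub>R P) o\<^sub>L ((2 ^ n * r n / norm (X n)) *\<^sub>R C) =
      ((\<delta> / norm z) * (2 ^ n * r n / norm (X n))) *\<^sub>R (P o\<^sub>L C)"
    by (rule blinfun_eqI) (simp add: scaleR_blinfun.rep_eq blinfun.scaleR_right)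
  also have "(\<delta> / norm z) * (2 ^ n * r n / norm (X n)) = norm x / norm (X n)"
    using \<delta>(1) z_ne by (simp add: r_def power_divide)
  finally have "mod_inner ((std_shift ^^ n) (sgn (X n))) (sgn z) \<in> V"
    using n(3) PCc by (simp add: V'(2) scaleR_scaleC compact_operators_scaleC)
  moreover have "(sgn (X n), sgn z) \<in> W" using n(1,2) z_ne by (simp add: W'(2) norm_sgn)
  ultimately show "\<exists>n\<ge>1. \<exists>(x, y)\<in>W. mod_inner ((std_shift ^^ n) x) y \<in> V"
    using n(4) by (intro exI[of _ n] conjI bexI[of _ "(sgn (X n), sgn z)"]) auto
qed

section \<open>Failure of supercyclicity on the module\<close>

text \<open>The functionals are diagonal matrix entries, at a unit vector \<open>b\<close>, of the
  odd coordinates, where the shift writes 0. Rank one projections placed at these coordinates are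
  biorthogonal to them.\<close>

lemma std_shift_not_supercyclic:
  fixes e :: "'i \<Rightarrow> 'h::chilbert_space"
  defines "T \<equiv> (std_shift :: 'h std_module \<Rightarrow> 'h std_module)"
  assumes onb: "orthonormal_basis e"
  shows "\<not> weakly_n_supercyclic n T" and "N \<ge> 1 \<Longrightarrow> \<not> N_weakly_supercyclic N T"
proof -
  \<comment> \<open>Types are inhabited, so some index exists, and orthonormality makes its basis
    vector a unit vector.\<close>
  fix i0 :: 'i
  define b where "b = e i0"
  have b: "cinner b b = 1" using onb_cinner[OF onb] by (simp add: b_def)
  then have "sqrt ((norm b)\<^sup>2) = 1" by (simp only: Re_cinner_self) simp
  then have nb: "norm b = 1" by simp
  define f where "f i x = cinner (mod_nth x (2 * i + 1) b) b" for i :: nat and x :: "'h std_module"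
  define u where "u i = std_single (2 * i + 1) (rank_one b)" for i :: nat
  have f: "bounded_clinear (f i)" for i
    unfolding bounded_clinear_def
  proof
    show "clinear (f i)"
      by (rule clinearI) (simp_all add: f_def plus_std_module.rep_eq scaleC_std_module.rep_eq
          plus_blinfun.rep_eq scaleC_blinfun.rep_eq cinner_add_left cinner_scaleC_left scaleC_complex_def)
    have "norm (f i x) \<le> 1 * norm x" for x
      using cinner_Cauchy_Schwarz[of "mod_nth x (2 * i + 1) b" b] norm_mod_nth_apply_le[of x "2 * i + 1" b]
      by (simp add: f_def nb)
    then show "\<exists>K. \<forall>x. norm (f i x) \<le> K * norm x" by blast
  qed
  have fT: "f i (T x) = 0" for i x
    by (simp add: T_def f_def std_shift.rep_eq gapped_shift_def)
  have u: "f i (u j) = (if i = j then 1 else 0)" for i j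
    by (simp add: f_def u_def mod_nth_std_single rank_one_compact rank_one_apply b scaleC_one)
  show "\<not> weakly_n_supercyclic n T"
    by (rule not_weakly_n_supercyclic_if_range_in_kernel[OF f fT, of 0 "u 0"]) (simp add: u)
  show "N \<ge> 1 \<Longrightarrow> \<not> N_weakly_supercyclic N T"
    by (rule not_N_weakly_supercyclic_if_range_in_kernels[OF f fT u])
qed

section \<open>The shift on the sequence space\<close>

lemma ell2_nth_summable: "summable (\<lambda>n. (cmod (ell2_nth x n))\<^sup>2)"
  using ell2_nth[of x] by simp

lemma norm_ell2_sq: "(norm x)\<^sup>2 = (\<Sum>n. (cmod (ell2_nth x n))\<^sup>2)"
  by (simp add: norm_ell2.rep_eq suminf_nonneg ell2_nth_summable)

lemma L2_set_ell2_le: "L2_set (\<lambda>n. cmod (ell2_nth x n)) {..<n} \<le> norm x"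
  unfolding L2_set_def norm_ell2.rep_eq
  by (intro real_sqrt_le_mono sum_le_suminf ell2_nth_summable) auto

lemma ell2_nth_scaleR: "ell2_nth (r *\<^sub>R x) n = complex_of_real r * ell2_nth x n"
  by (simp add: scaleR_ell2_def scaleC_ell2.rep_eq)

lemma ell2_nth_diff: "ell2_nth (x - y) n = ell2_nth x n - ell2_nth y n"
  unfolding minus_ell2_def plus_ell2.rep_eq uminus_ell2.rep_eq by simp

section \<open>The inner product of the sequence space\<close>

definition ell2_inner :: "ell2 \<Rightarrow> ell2 \<Rightarrow> complex" where
  "ell2_inner x y = (\<Sum>n. ell2_nth x n * cnj (ell2_nth y n))"

lemma ell2_inner_bound:
  "(\<Sum>i<n. norm (ell2_nth x i * cnj (ell2_nth y i))) \<le> norm x * norm y"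
proof -
  have "(\<Sum>i<n. norm (ell2_nth x i * cnj (ell2_nth y i))) =
      (\<Sum>i<n. \<bar>cmod (ell2_nth x i)\<bar> * \<bar>cmod (ell2_nth y i)\<bar>)"
    by (simp add: norm_mult)
  also have "\<dots> \<le> L2_set (\<lambda>i. cmod (ell2_nth x i)) {..<n} * L2_set (\<lambda>i. cmod (ell2_nth y i)) {..<n}"
    by (rule L2_set_mult_ineq)
  also have "\<dots> \<le> norm x * norm y"
    by (intro mult_mono L2_set_ell2_le) auto
  finally show ?thesis .
qed

lemma ell2_inner_summable_norm: "summable (\<lambda>n. norm (ell2_nth x n * cnj (ell2_nth y n)))"
  by (rule summableI_nonneg_bounded[OF _ ell2_inner_bound]) simp

lemma ell2_inner_summable: "summable (\<lambda>n. ell2_nth x n * cnj (ell2_nth y n))"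
  by (rule summable_norm_cancel[OF ell2_inner_summable_norm])

lemma ell2_inner_Cauchy_Schwarz: "cmod (ell2_inner x y) \<le> norm x * norm y"
proof -
  have "cmod (ell2_inner x y) \<le> (\<Sum>n. norm (ell2_nth x n * cnj (ell2_nth y n)))"
    unfolding ell2_inner_def by (rule summable_norm[OF ell2_inner_summable_norm])
  also have "\<dots> \<le> norm x * norm y"
    by (rule suminf_le_const[OF ell2_inner_summable_norm ell2_inner_bound])
  finally show ?thesis .
qed

lemma ell2_inner_add_left: "ell2_inner (x + y) z = ell2_inner x z + ell2_inner y z"
  unfolding ell2_inner_def
  by (simp add: plus_ell2.rep_eq suminf_add[OF ell2_inner_summable ell2_inner_summable] distrib_right)

lemma ell2_inner_scaleC_left: "ell2_inner (c *\<^sub>C x) y = c * ell2_inner x y"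
  unfolding ell2_inner_def
  by (simp add: scaleC_ell2.rep_eq suminf_mult[OF ell2_inner_summable] mult.assoc)

lemma ell2_inner_commute: "ell2_inner x y = cnj (ell2_inner y x)"
  unfolding ell2_inner_def
  by (simp add: bounded_linear.suminf[OF bounded_linear_cnj ell2_inner_summable] mult.commute)

lemma ell2_inner_add_right: "ell2_inner x (y + z) = ell2_inner x y + ell2_inner x z"
  by (metis ell2_inner_add_left ell2_inner_commute complex_cnj_add)

lemma ell2_inner_scaleC_right: "ell2_inner x (c *\<^sub>C y) = cnj c * ell2_inner x y"
  by (metis ell2_inner_scaleC_left ell2_inner_commute complex_cnj_mult)

lemma ell2_inner_self: "ell2_inner x x = complex_of_real ((norm x)\<^sup>2)"
  unfolding ell2_inner_def norm_ell2_sq suminf_of_real[OF ell2_nth_summable]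
  by (simp only: complex_norm_square)

lemma norm_ell2_add_orthogonal:
  assumes "ell2_inner w x = 0"
  shows "(norm (x + c *\<^sub>C w))\<^sup>2 = (norm x)\<^sup>2 + (cmod c)\<^sup>2 * (norm w)\<^sup>2"
proof -
  have "ell2_inner x w = 0" using assms ell2_inner_commute[of x w] by simp
  then have "ell2_inner (x + c *\<^sub>C w) (x + c *\<^sub>C w) = ell2_inner x x + (c * cnj c) * ell2_inner w w"
    using assms
    by (simp add: ell2_inner_add_left ell2_inner_add_right ell2_inner_scaleC_left ell2_inner_scaleC_right)
  then have "complex_of_real ((norm (x + c *\<^sub>C w))\<^sup>2) =
      complex_of_real ((norm x)\<^sup>2 + (cmod c)\<^sup>2 * (norm w)\<^sup>2)"
    unfolding ell2_inner_self by (simp add: complex_norm_square[symmetric])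
  then show ?thesis by (rule of_real_eq_iff[THEN iffD1])
qed

section \<open>Norming functionals of the sequence space\<close>

definition ell2_functional :: "ell2 \<Rightarrow> ell2 \<Rightarrow>\<^sub>L complex" where
  "ell2_functional y = Blinfun (\<lambda>x. ell2_inner x y)"

lemma ell2_functional_apply: "ell2_functional y x = ell2_inner x y"
proof -
  have "bounded_linear (\<lambda>x. ell2_inner x y)"
    by (rule bounded_linear_intro[where K = "norm y"])
      (simp_all add: ell2_inner_add_left scaleR_scaleC ell2_inner_scaleC_left
        ell2_inner_Cauchy_Schwarz scaleC_complex_def)
  then show ?thesis by (simp add: ell2_functional_def bounded_linear_Blinfun_apply)
qed

lemma norm_ell2_functional_le: "norm (ell2_functional y) \<le> norm y"
  by (rule norm_blinfun_bound)
    (use ell2_inner_Cauchy_Schwarz[of _ y] in \<open>auto simp: ell2_functional_apply mult.commute\<close>)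

text \<open>The assignment is conjugate linear, hence real linear. Its boundedness makes the norming
  functional depend continuously on the unit vector.\<close>

lemma bounded_linear_ell2_functional: "bounded_linear ell2_functional"
proof (rule bounded_linear_intro[where K = 1])
  show "ell2_functional (x + y) = ell2_functional x + ell2_functional y" for x y
    by (rule blinfun_eqI) (simp add: ell2_functional_apply plus_blinfun.rep_eq ell2_inner_add_right)
  show "ell2_functional (r *\<^sub>R x) = r *\<^sub>R ell2_functional x" for r x
    by (rule blinfun_eqI)
      (simp add: ell2_functional_apply scaleR_blinfun.rep_eq scaleR_ell2_def ell2_inner_scaleC_right
        scaleR_conv_of_real)
qed (simp add: norm_ell2_functional_le)

lemma norming_pair_ell2_functional:
  assumes "norm x = 1"
  shows "(x, ell2_functional x) \<in> norming_pairs"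
proof -
  have 1: "ell2_functional x x = 1" using assms by (simp add: ell2_functional_apply ell2_inner_self)
  have "clinear (blinfun_apply (ell2_functional x))"
    by (rule clinearI)
      (simp_all add: ell2_functional_apply ell2_inner_add_left ell2_inner_scaleC_left scaleC_complex_def)
  moreover have "norm (ell2_functional x) = 1"
    using norm_ell2_functional_le[of x] norm_blinfun[of "ell2_functional x" x] assms 1 by simp
  ultimately show ?thesis using assms 1 by (simp add: norming_pairs_def)
qed

text \<open>If \<open>w\<close> is orthogonal to \<open>x\<close>, moving from \<open>x\<close> by \<open>t\<close> in the direction of \<open>w\<close> raises the norm
  only to second order in \<open>t\<close>, so a norming functional of \<open>x\<close> cannot change to first order.\<close>

lemma norming_pair_ell2_unique:
  fixes x :: ell2
  assumes "(x, f) \<in> norming_pairs"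
  shows "f = ell2_functional x"
proof -
  have x: "norm x = 1" and cl: "clinear (blinfun_apply f)" and f: "norm f = 1" and fx: "f x = 1"
    using assms by (auto simp: norming_pairs_def)
  have orth: "f w = 0" if w: "ell2_inner w x = 0" for w
  proof (rule ccontr)
    define a where "a = f w"
    assume "f w \<noteq> 0"
    then have a: "a \<noteq> 0" by (simp add: a_def)
    \<comment> \<open>This \<open>t\<close> keeps \<open>t * (norm w)\<^sup>2\<close> below 1, so
      the linear gain \<open>t * (cmod a)\<^sup>2\<close> of \<open>f\<close> beats the quadratic
      growth of the norm. The factor \<open>cnj a\<close> in \<open>?c\<close> makes that gain real
      and positive.\<close>
    define t where "t = 1 / ((norm w)\<^sup>2 + 1)"
    have t: "t > 0" "t * (norm w)\<^sup>2 < 1"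
      by (auto simp: t_def add_nonneg_pos divide_less_eq)
    let ?c = "complex_of_real t * cnj a"
    have "f (x + ?c *\<^sub>C w) = 1 + complex_of_real t * (a * cnj a)"
      by (simp add: clinear_add[OF cl] clinear_scaleC[OF cl] fx a_def scaleC_complex_def mult_ac)
    also have "\<dots> = complex_of_real (1 + t * (cmod a)\<^sup>2)"
      by (simp add: complex_norm_square[symmetric])
    finally have "1 + t * (cmod a)\<^sup>2 = norm (f (x + ?c *\<^sub>C w))"
      using t(1) by (simp only: norm_of_real) simp
    also have "\<dots> \<le> norm (x + ?c *\<^sub>C w)"
      using norm_blinfun[of f "x + ?c *\<^sub>C w"] f by simp
    finally have "(1 + t * (cmod a)\<^sup>2)\<^sup>2 \<le> (norm (x + ?c *\<^sub>C w))\<^sup>2"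
      using t(1) by (intro power_mono) auto
    also have "\<dots> = 1 + t\<^sup>2 * (cmod a)\<^sup>2 * (norm w)\<^sup>2"
      unfolding norm_ell2_add_orthogonal[OF w] by (simp add: x norm_mult power_mult_distrib)
    finally have "1 + 2 * (t * (cmod a)\<^sup>2) + (t * (cmod a)\<^sup>2)\<^sup>2 \<le> 1 + (t * (cmod a)\<^sup>2) * (t * (norm w)\<^sup>2)"
      by (simp add: power2_eq_square algebra_simps)
    moreover have "(t * (cmod a)\<^sup>2) * (t * (norm w)\<^sup>2) \<le> (t * (cmod a)\<^sup>2) * 1"
      using t by (intro mult_left_mono) auto
    moreover have "t * (cmod a)\<^sup>2 > 0" using t a by simp
    moreover have "(t * (cmod a)\<^sup>2)\<^sup>2 \<ge> 0" by simp
    ultimately show False by linarith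
  qed
  show ?thesis
  proof (rule blinfun_eqI)
    fix y
    \<comment> \<open>Since \<open>x\<close> is a unit vector, removing \<open>c *\<^sub>C x\<close>
      from \<open>y\<close> leaves a vector orthogonal to \<open>x\<close>, on which
      \<open>f\<close> vanishes.\<close>
    define c where "c = ell2_inner y x"
    have "ell2_inner (y + (- c) *\<^sub>C x) x = 0"
      unfolding ell2_inner_add_left ell2_inner_scaleC_left ell2_inner_self x c_def by simp
    from orth[OF this] have "f y + (- c) * f x = 0"
      by (simp only: clinear_add[OF cl] clinear_scaleC[OF cl] scaleC_complex_def)
    then have "f y = c" by (simp add: fx)
    then show "f y = ell2_functional x y" by (simp add: ell2_functional_apply c_def)
  qed
qed

section \<open>Truncations and the shift on sequences\<close>

lift_definition ell2_single :: "nat \<Rightarrow> ell2" is "\<lambda>k j. if j = k then 1 else 0"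
  by (rule summable_finite[of "{k}" for k]) auto

lift_definition ell2_truncate :: "nat \<Rightarrow> ell2 \<Rightarrow> ell2" is "\<lambda>n x j. if j < n then x j else 0"
  by (rule summable_finite[of "{..<n}" for n]) auto

lemma norm_ell2_single: "norm (ell2_single k) = 1"
proof -
  have "(\<Sum>j. (cmod (ell2_nth (ell2_single k) j))\<^sup>2) = (\<Sum>j\<in>{k}. (cmod (ell2_nth (ell2_single k) j))\<^sup>2)"
    by (rule suminf_finite) (auto simp: ell2_single.rep_eq)
  then show ?thesis by (simp add: norm_ell2.rep_eq) (simp add: ell2_single.rep_eq)
qed

lemma ell2_truncate_LIMSEQ: "(\<lambda>n. ell2_truncate n x) \<longlonglongrightarrow> x"
proof -
  let ?g = "\<lambda>j. (cmod (ell2_nth x j))\<^sup>2"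
  have d: "(norm (x - ell2_truncate n x))\<^sup>2 = (norm x)\<^sup>2 - (\<Sum>j<n. ?g j)" for n
  proof -
    have "?g sums (norm x)\<^sup>2" unfolding norm_ell2_sq by (rule summable_sums[OF ell2_nth_summable])
    from sums_diff[OF this sums_If_finite_set[of "{..<n}" ?g]]
    have "(\<lambda>j. ?g j - (if j < n then ?g j else 0)) sums ((norm x)\<^sup>2 - (\<Sum>j<n. ?g j))" by simp
    moreover have "?g j - (if j < n then ?g j else 0) = (cmod (ell2_nth (x - ell2_truncate n x) j))\<^sup>2" for j
      by (simp add: ell2_nth_diff ell2_truncate.rep_eq)
    ultimately show ?thesis unfolding norm_ell2_sq[of "x - ell2_truncate n x"] by (simp add: sums_iff)
  qed
  have "(\<lambda>n. (norm x)\<^sup>2 - (\<Sum>j<n. ?g j)) \<longlonglongrightarrow> (norm x)\<^sup>2 - (norm x)\<^sup>2"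
    unfolding norm_ell2_sq
    by (intro tendsto_diff tendsto_const summable_LIMSEQ ell2_nth_summable)
  then have "(\<lambda>n. sqrt ((norm (x - ell2_truncate n x))\<^sup>2)) \<longlonglongrightarrow> sqrt ((norm x)\<^sup>2 - (norm x)\<^sup>2)"
    unfolding d[symmetric] by (rule tendsto_real_sqrt)
  then have "(\<lambda>n. dist (ell2_truncate n x) x) \<longlonglongrightarrow> 0"
    by (simp add: dist_norm norm_minus_commute[of _ x])
  then show ?thesis by (rule tendsto_dist_iff[THEN iffD2])
qed

lemma ell2_gapped_shift:
  fixes x :: "nat \<Rightarrow> complex"
  assumes x: "summable (\<lambda>n. (cmod (x n))\<^sup>2)"
  shows "summable (\<lambda>n. (cmod (gapped_shift x n))\<^sup>2)"
    and "(\<Sum>n. (cmod (gapped_shift x n))\<^sup>2) \<le> 4 * (\<Sum>n. (cmod (x n))\<^sup>2)"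
proof -
  have le: "(cmod (gapped_shift x n))\<^sup>2 \<le> 4 * (cmod (x (n + 2)))\<^sup>2" for n
    by (simp add: gapped_shift_def scaleC_complex_def norm_mult power_mult_distrib)
  have s: "summable (\<lambda>n. 4 * (cmod (x (n + 2)))\<^sup>2)"
    by (intro summable_mult summable_ignore_initial_segment[OF x])
  show s': "summable (\<lambda>n. (cmod (gapped_shift x n))\<^sup>2)"
    by (rule summable_comparison_test'[OF s, of 0]) (use le in simp)
  have "(\<Sum>n. (cmod (gapped_shift x n))\<^sup>2) \<le> (\<Sum>n. 4 * (cmod (x (n + 2)))\<^sup>2)"
    by (rule suminf_le[OF le s' s])
  also have "\<dots> = 4 * (\<Sum>n. (cmod (x (n + 2)))\<^sup>2)"
    by (rule suminf_mult[OF summable_ignore_initial_segment[OF x]])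
  also have "(\<Sum>n. (cmod (x (n + 2)))\<^sup>2) = (\<Sum>n. (cmod (x n))\<^sup>2) - (\<Sum>n<2. (cmod (x n))\<^sup>2)"
    by (rule suminf_minus_initial_segment[OF x])
  also have "4 * \<dots> \<le> 4 * (\<Sum>n. (cmod (x n))\<^sup>2)" by (simp add: sum_nonneg)
  finally show "(\<Sum>n. (cmod (gapped_shift x n))\<^sup>2) \<le> 4 * (\<Sum>n. (cmod (x n))\<^sup>2)" by simp
qed

lift_definition ell2_shift :: "ell2 \<Rightarrow> ell2" is gapped_shift
  by (rule ell2_gapped_shift(1))

lemma ell2_nth_shift_funpow: "ell2_nth ((ell2_shift ^^ n) x) = (gapped_shift ^^ n) (ell2_nth x)"
  by (induction n) (simp_all add: ell2_shift.rep_eq)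

lemma bounded_clinear_ell2_shift: "bounded_clinear ell2_shift"
  unfolding bounded_clinear_def
proof
  show "clinear ell2_shift"
  proof (rule clinearI)
    show "ell2_shift (x + y) = ell2_shift x + ell2_shift y" for x y
      by transfer (simp add: gapped_shift_def fun_eq_iff scaleC_complex_def distrib_left)
    show "ell2_shift (c *\<^sub>C x) = c *\<^sub>C ell2_shift x" for c x
      by transfer (simp add: gapped_shift_def fun_eq_iff scaleC_complex_def)
  qed
  have "norm (ell2_shift x) \<le> 2 * norm x" for x
  proof -
    have "sqrt (\<Sum>n. (cmod (ell2_nth (ell2_shift x) n))\<^sup>2) \<le> sqrt (4 * (\<Sum>n. (cmod (ell2_nth x n))\<^sup>2))"
      unfolding ell2_shift.rep_eq
      by (rule real_sqrt_le_mono[OF ell2_gapped_shift(2)[OF ell2_nth_summable]])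
    then show ?thesis by (simp add: norm_ell2.rep_eq real_sqrt_mult)
  qed
  then show "\<exists>K. \<forall>x. norm (ell2_shift x) \<le> K * norm x" by blast
qed

section \<open>Numerical transitivity and failure of supercyclicity on sequences\<close>

text \<open>Norming functionals are unique here, so a pair is determined by its unit vector. It
  suffices to perturb the vector and let the functional follow continuously.\<close>

lemma numerically_transitive_ell2_shift: "numerically_transitive ell2_shift"
  unfolding numerically_transitive_def
proof (intro allI impI, elim conjE)
  fix U :: "(ell2 \<times> (ell2 \<Rightarrow>\<^sub>L complex)) set" and V :: "complex set"
  assume "openin (top_of_set norming_pairs) U" and "U \<noteq> {}" and V: "open V" "V \<noteq> {}"
  then obtain U' where U': "open U'" "U = norming_pairs \<inter> U'" by (auto simp: openin_open)
  from V obtain v where v: "v \<in> V" by auto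
  from \<open>U \<noteq> {}\<close> obtain x0 f0 where "(x0, f0) \<in> U" by auto
  then have x0: "norm x0 = 1" and xU: "(x0, ell2_functional x0) \<in> U'"
    using norming_pair_ell2_unique[of x0 f0] by (auto simp: U'(2) norming_pairs_def)
  \<comment> \<open>Every nonzero vector yields a norming pair after normalisation, continuously
    away from 0. Perturbations can thus be made without watching the norm.\<close>
  define \<Phi> where "\<Phi> x = (sgn x, ell2_functional (sgn x))" for x
  have \<Phi>: "(\<lambda>n. \<Phi> (g n)) \<longlonglongrightarrow> \<Phi> l" if "g \<longlonglongrightarrow> l" "l \<noteq> 0" for g l
    unfolding \<Phi>_def using that
    by (intro tendsto_Pair tendsto_sgn bounded_linear.tendsto[OF bounded_linear_ell2_functional])
  have "\<Phi> x0 \<in> U'" using xU x0 by (simp add: \<Phi>_def sgn_div_norm)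
  have x0_ne: "x0 \<noteq> 0" using x0 by auto
  have "\<forall>\<^sub>F k in sequentially. ell2_truncate k x0 \<noteq> 0 \<and> \<Phi> (ell2_truncate k x0) \<in> U' \<and> k \<ge> 1"
    using tendsto_imp_eventually_ne[OF ell2_truncate_LIMSEQ x0_ne]
      topological_tendstoD[OF \<Phi>[OF ell2_truncate_LIMSEQ x0_ne] U'(1) \<open>\<Phi> x0 \<in> U'\<close>]
      eventually_ge_at_top[of 1]
    by (simp add: eventually_conj)
  then obtain k where k: "ell2_truncate k x0 \<noteq> 0" "\<Phi> (ell2_truncate k x0) \<in> U'" "k \<ge> 1"
    using eventually_happens'[OF sequentially_bot] by blast
  define y where "y = ell2_truncate k x0"
  have yk: "ell2_nth y j = 0" if "j \<ge> k" for j using that by (simp add: y_def ell2_truncate.rep_eq)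

  \<comment> \<open>The entry moved by the shift will be paired with coordinate 0 of the vector
    itself, which must therefore be nonzero. Having \<open>k\<close> at least 1 keeps this
    correction below \<open>k\<close>.\<close>
  obtain x where x: "x \<noteq> 0" "\<Phi> x \<in> U'" "ell2_nth x 0 \<noteq> 0" and xk: "\<And>j. j \<ge> k \<Longrightarrow> ell2_nth x j = 0"
  proof (cases "ell2_nth y 0 = 0")
    case False
    with k yk show ?thesis by (intro that[of y]) (auto simp: y_def)
  next
    case True
    let ?y = "\<lambda>n. y + inverse (real (Suc n)) *\<^sub>R ell2_single 0"
    have "?y \<longlonglongrightarrow> y + 0 *\<^sub>R ell2_single 0"
      by (intro tendsto_add tendsto_scaleR tendsto_const LIMSEQ_inverse_real_of_nat)
    then have ty: "?y \<longlonglongrightarrow> y" by simp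
    have y: "y \<noteq> 0" "\<Phi> y \<in> U'" using k by (simp_all add: y_def)
    have "\<forall>\<^sub>F n in sequentially. ?y n \<noteq> 0 \<and> \<Phi> (?y n) \<in> U'"
      using tendsto_imp_eventually_ne[OF ty y(1)] topological_tendstoD[OF \<Phi>[OF ty y(1)] U'(1) y(2)]
      by (simp add: eventually_conj)
    then obtain n where n: "?y n \<noteq> 0" "\<Phi> (?y n) \<in> U'"
      using eventually_happens'[OF sequentially_bot] by blast
    have nth: "ell2_nth (?y n) j = ell2_nth y j + (if j = 0 then of_real (inverse (real (Suc n))) else 0)" for j
      by (simp only: plus_ell2.rep_eq ell2_nth_scaleR ell2_single.rep_eq) simp
    show ?thesis
    proof (rule that[of "?y n"])
      show "ell2_nth (?y n) 0 \<noteq> 0" unfolding nth using True by (simp del: of_nat_Suc)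
      show "ell2_nth (?y n) j = 0" if "j \<ge> k" for j unfolding nth using that yk[of j] k(3) by simp
    qed (rule n)+
  qed

  \<comment> \<open>The powers of 2 cancel against the shift, and the denominator cancels against
    the conjugated coordinate 0 in the pairing. The two normalisations leave \<open>v\<close> times
    a ratio tending to 1.\<close>
  define c where "c n = v * of_real ((norm x)\<^sup>2) / cnj (ell2_nth x 0) * (1 / 2) ^ n" for n
  define X where "X n = x + c n *\<^sub>C ell2_single (2 * n)" for n
  have c0: "c \<longlonglongrightarrow> 0"
    unfolding c_def by (intro tendsto_mult_right_zero LIMSEQ_power_zero) (simp add: norm_divide)
  have X: "X \<longlonglongrightarrow> x"
  proof (rule tendsto_dist_iff[THEN iffD2])
    have "(\<lambda>n. norm (c n)) \<longlonglongrightarrow> 0" by (rule tendsto_norm_zero[OF c0])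
    then show "(\<lambda>n. dist (X n) x) \<longlonglongrightarrow> 0"
      by (simp add: X_def dist_norm norm_scaleC norm_ell2_single)
  qed
  have "(\<lambda>n. v * of_real ((norm x)\<^sup>2 / (norm (X n))\<^sup>2)) \<longlonglongrightarrow> v * of_real ((norm x)\<^sup>2 / (norm x)\<^sup>2)"
    by (intro tendsto_mult tendsto_of_real tendsto_divide tendsto_power tendsto_const tendsto_norm X)
      (simp add: x(1))
  then have lim: "(\<lambda>n. v * of_real ((norm x)\<^sup>2 / (norm (X n))\<^sup>2)) \<longlonglongrightarrow> v" using x(1) by simp
  have "\<forall>\<^sub>F n in sequentially. X n \<noteq> 0 \<and> \<Phi> (X n) \<in> U' \<and>
      v * of_real ((norm x)\<^sup>2 / (norm (X n))\<^sup>2) \<in> V \<and> n \<ge> k"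
    using tendsto_imp_eventually_ne[OF X x(1)] topological_tendstoD[OF \<Phi>[OF X x(1)] U'(1) x(2)]
      topological_tendstoD[OF lim V(1) v] eventually_ge_at_top[of k]
    by (simp add: eventually_conj)
  then obtain n where n: "X n \<noteq> 0" "\<Phi> (X n) \<in> U'" "n \<ge> k"
      "v * of_real ((norm x)\<^sup>2 / (norm (X n))\<^sup>2) \<in> V"
    using eventually_happens'[OF sequentially_bot] by blast
  have sgn_nth: "ell2_nth (sgn (X n)) j = ell2_nth (X n) j / of_real (norm (X n))" for j
    by (simp add: sgn_div_norm ell2_nth_scaleR field_simps)
  have Xn: "ell2_nth (X n) j = ell2_nth x j + (if j = 2 * n then c n else 0)" for j
    by (simp add: X_def plus_ell2.rep_eq scaleC_ell2.rep_eq ell2_single.rep_eq)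
  \<comment> \<open>Since \<open>n\<close> is at least \<open>k\<close>, the contribution of
    \<open>x\<close> is gone and the entry from \<open>2 * n\<close> arrives at 0. As
    \<open>n\<close> is positive, coordinate 0 of \<open>X n\<close> itself is still that of
    \<open>x\<close>.\<close>
  have T: "ell2_nth ((ell2_shift ^^ n) (sgn (X n))) j =
      (if j = 0 then 2 ^ n * c n / of_real (norm (X n)) else 0)" for j
    using n(3) k(3)
    by (auto simp: ell2_nth_shift_funpow gapped_shift_funpow scaleC_complex_def sgn_nth Xn xk)
  have "ell2_inner ((ell2_shift ^^ n) (sgn (X n))) (sgn (X n)) =
      (\<Sum>j\<in>{0}. ell2_nth ((ell2_shift ^^ n) (sgn (X n))) j * cnj (ell2_nth (sgn (X n)) j))"
    unfolding ell2_inner_def by (rule suminf_finite) (auto simp: T)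
  also have "\<dots> = 2 ^ n * c n / of_real (norm (X n)) * cnj (ell2_nth x 0 / of_real (norm (X n)))"
    using n(3) k(3) by (simp add: T sgn_nth Xn)
  also have "\<dots> = v * of_real ((norm x)\<^sup>2 / (norm (X n))\<^sup>2)"
    using x(3) n(1) by (simp add: c_def power_divide power2_eq_square)
  finally have "ell2_functional (sgn (X n)) ((ell2_shift ^^ n) (sgn (X n))) \<in> V"
    using n(4) by (simp add: ell2_functional_apply)
  moreover have "(sgn (X n), ell2_functional (sgn (X n))) \<in> U"
    using n(1,2) norming_pair_ell2_functional[of "sgn (X n)"] by (simp add: U'(2) \<Phi>_def norm_sgn)
  ultimately show "\<exists>n. \<exists>(x, f)\<in>U. blinfun_apply f ((ell2_shift ^^ n) x) \<in> V" by blast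
qed

text \<open>The odd coordinates again vanish on the range. Writing them as inner products with unit
  sequences gives linearity and boundedness at once.\<close>

lemma ell2_shift_not_supercyclic:
  shows "\<not> weakly_n_supercyclic n ell2_shift" and "N \<ge> 1 \<Longrightarrow> \<not> N_weakly_supercyclic N ell2_shift"
proof -
  define f where "f i x = ell2_inner x (ell2_single (2 * i + 1))" for i :: nat and x
  define u where "u i = ell2_single (2 * i + 1)" for i :: nat
  have nth: "f i x = ell2_nth x (2 * i + 1)" for i x
  proof -
    have "f i x = (\<Sum>j\<in>{2 * i + 1}. ell2_nth x j * cnj (ell2_nth (ell2_single (2 * i + 1)) j))"
      unfolding f_def ell2_inner_def by (rule suminf_finite) (auto simp: ell2_single.rep_eq)
    then show ?thesis by (simp add: ell2_single.rep_eq)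
  qed
  have f: "bounded_clinear (f i)" for i
    unfolding bounded_clinear_def
  proof
    show "clinear (f i)"
      by (rule clinearI) (simp_all add: f_def ell2_inner_add_left ell2_inner_scaleC_left scaleC_complex_def)
    have "norm (f i x) \<le> 1 * norm x" for x
      using ell2_inner_Cauchy_Schwarz[of x "ell2_single (2 * i + 1)"] by (simp add: f_def norm_ell2_single)
    then show "\<exists>K. \<forall>x. norm (f i x) \<le> K * norm x" by blast
  qed
  have fT: "f i (ell2_shift x) = 0" for i x
    by (simp add: nth ell2_shift.rep_eq gapped_shift_def)
  have u: "f i (u j) = (if i = j then 1 else 0)" for i j
    by (simp add: nth u_def ell2_single.rep_eq)
  show "\<not> weakly_n_supercyclic n ell2_shift"
    by (rule not_weakly_n_supercyclic_if_range_in_kernel[OF f fT, of 0 "u 0"]) (simp add: u)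
  show "N \<ge> 1 \<Longrightarrow> \<not> N_weakly_supercyclic N ell2_shift"
    by (rule not_N_weakly_supercyclic_if_range_in_kernels[OF f fT u])
qed

theorem corollary4p11:
  fixes e :: "int \<Rightarrow> 'h::chilbert_space"
  assumes "orthonormal_basis e"
  shows
    "(\<exists>T :: 'h std_module \<Rightarrow> 'h std_module. bounded_clinear T \<and> Cstar_transitive T \<and>
        (\<forall>n\<ge>1. \<not> weakly_n_supercyclic n T) \<and> (\<forall>N\<ge>1. \<not> N_weakly_supercyclic N T)) \<and>
     (\<exists>T :: ell2 \<Rightarrow> ell2. bounded_clinear T \<and> numerically_transitive T \<and>
        (\<forall>n\<ge>1. \<not> weakly_n_supercyclic n T) \<and> (\<forall>N\<ge>1. \<not> N_weakly_supercyclic N T))"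
proof (intro conjI)
  have "bounded_clinear T \<and> Cstar_transitive T \<and>
      (\<forall>n\<ge>1. \<not> weakly_n_supercyclic n T) \<and> (\<forall>N\<ge>1. \<not> N_weakly_supercyclic N T)"
    if "T = std_shift" for T :: "'h std_module \<Rightarrow> 'h std_module"
    using that bounded_clinear_std_shift Cstar_transitive_std_shift[OF assms]
      std_shift_not_supercyclic[OF assms]
    by simp
  then show "\<exists>T :: 'h std_module \<Rightarrow> 'h std_module. bounded_clinear T \<and> Cstar_transitive T \<and>
      (\<forall>n\<ge>1. \<not> weakly_n_supercyclic n T) \<and> (\<forall>N\<ge>1. \<not> N_weakly_supercyclic N T)"
    by blast
  show "\<exists>T :: ell2 \<Rightarrow> ell2. bounded_clinear T \<and> numerically_transitive T \<and>
      (\<forall>n\<ge>1. \<not> weakly_n_supercyclic n T) \<and> (\<forall>N\<ge>1. \<not> N_weakly_supercyclic N T)"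
    by (intro exI[of _ ell2_shift] conjI allI impI bounded_clinear_ell2_shift
        numerically_transitive_ell2_shift ell2_shift_not_supercyclic)
qed

end
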